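(* Let $N\ge1$, let $q>2$ and let $1<p<2$. Then there exist $\mu=\mu(p,q)\in\left(0,\frac1p\right)$ and a constant $C=C(p,q)$ such that for every function $f\in L^2(\mathbb{R}^N)$, $$\|f\|_{X_{p,q}}\leq C\left[\sup_{(j,k)\in\mathbb{Z}\times\mathbb{Z}^N}2^{j\frac N2(2-p)}\int_{\tau^j_k}|f(x)|^p\,dx\right]^{\mu}\|f\|_{L^2(\mathbb{R}^N)}^{1-\mu p}\leq C\|f\|_{L^2(\mathbb{R}^N)}.$$ In particular, $L^2(\mathbb{R}^N)\hookrightarrow X_{p,q}$ (continuous embedding). Moreover, $L^2(\mathbb{R}^N)\neq X_{p,q}$.
   Context: For $j\in\mathbb{Z}$ and $k=(k_1,\dots,k_N)\in\mathbb{Z}^N$ let $\tau^j_k=\prod_{m=1}^N[k_m2^{-j},(k_m+1)2^{-j})$ be the dyadic cube of side $2^{-j}$, and $f^j_k=f\chi_{\tau^j_k}$. For $1\le p,q<\infty$, $$X_{p,q}=\{f\in L^p_{\rm loc}(\mathbb{R}^N):\|f\|_{X_{p,q}}<\infty\},\qquad \|f\|_{X_{p,q}}=\Big[\sum_{j\in\mathbb{Z}}2^{j\frac N2\frac{2-p}{p}q}\sum_{k\in\mathbb{Z}^N}\|f^j_k\|_{L^p(\mathbb{R}^N)}^q\Big]^{1/q}.$$ *)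

theory Defs
  imports "HOL-Analysis.Analysis"
begin

text \<open>
  The constants in the theorem are uniform in the dimension \<open>N\<close>, so \<open>N\<close> is a natural number and
  not a type: \<open>\<real>\<^sup>N\<close> is the set of extensional functions on \<open>{1..N}\<close>, and Lebesgue measure on it
  is the completion of the \<open>N\<close>-fold product of Borel-Lebesgue measure on the line.
  Functions are complex-valued and are not identified almost everywhere. All function spaces below
  are closed under modification on null sets, so inclusions and (in)equalities between them mean
  the same as for the spaces of equivalence classes.
\<close>

definition leb :: "nat \<Rightarrow> (nat \<Rightarrow> real) measure" where
  "leb N = completion (Pi\<^sub>M {1..N} (\<lambda>_. lborel))"

definition int_points :: "nat \<Rightarrow> (nat \<Rightarrow> int) set" where
  "int_points N = {1..N} \<rightarrow>\<^sub>E UNIV"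

definition cube :: "nat \<Rightarrow> int \<Rightarrow> (nat \<Rightarrow> int) \<Rightarrow> (nat \<Rightarrow> real) set" where
  "cube N j k =
    (\<Pi>\<^sub>E m\<in>{1..N}. {real_of_int (k m) * 2 powi (- j) ..< (real_of_int (k m) + 1) * 2 powi (- j)})"

text \<open>Norms take the value \<open>\<infinity>\<close> off the corresponding space. The power below is only used with
  exponent \<open>a > 0\<close>, for which \<open>0\<close> to the power \<open>a\<close> is \<open>0\<close> and \<open>\<infinity>\<close> to the power \<open>a\<close> is \<open>\<infinity>\<close>.\<close>

definition ennpow :: "ennreal \<Rightarrow> real \<Rightarrow> ennreal" where
  "ennpow x a = (if x = \<infinity> then \<infinity> else ennreal (enn2real x powr a))"

definition Lp_norm :: "nat \<Rightarrow> real \<Rightarrow> ((nat \<Rightarrow> real) \<Rightarrow> complex) \<Rightarrow> ennreal" where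
  "Lp_norm N p f = ennpow (\<integral>\<^sup>+x. ennreal (norm (f x) powr p) \<partial>leb N) (1 / p)"

definition Lp_space :: "nat \<Rightarrow> real \<Rightarrow> ((nat \<Rightarrow> real) \<Rightarrow> complex) set" where
  "Lp_space N p = {f \<in> borel_measurable (leb N). Lp_norm N p f < \<infinity>}"

text \<open>The topology on \<open>nat \<Rightarrow> real\<close> is the product topology; the coordinates outside \<open>{1..N}\<close> are
  constant on the space of the measure, so its compact subsets are those of \<open>\<real>\<^sup>N\<close>.\<close>

definition Lp_loc :: "nat \<Rightarrow> real \<Rightarrow> ((nat \<Rightarrow> real) \<Rightarrow> complex) set" where
  "Lp_loc N p = {f \<in> borel_measurable (leb N).
     \<forall>K. compact K \<and> K \<subseteq> space (leb N) \<longrightarrow>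
       (\<integral>\<^sup>+x\<in>K. ennreal (norm (f x) powr p) \<partial>leb N) < \<infinity>}"

definition cube_restrict ::
  "nat \<Rightarrow> int \<Rightarrow> (nat \<Rightarrow> int) \<Rightarrow> ((nat \<Rightarrow> real) \<Rightarrow> complex) \<Rightarrow> (nat \<Rightarrow> real) \<Rightarrow> complex" where
  "cube_restrict N j k f = (\<lambda>x. f x * indicator (cube N j k) x)"

definition X_norm :: "nat \<Rightarrow> real \<Rightarrow> real \<Rightarrow> ((nat \<Rightarrow> real) \<Rightarrow> complex) \<Rightarrow> ennreal" where
  "X_norm N p q f =
    ennpow
      (\<Sum>\<^sub>\<infinity>j\<in>UNIV. ennreal (2 powr (real_of_int j * (real N / 2) * ((2 - p) / p) * q)) *
         (\<Sum>\<^sub>\<infinity>k\<in>int_points N. ennpow (Lp_norm N p (cube_restrict N j k f)) q))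
      (1 / q)"

definition X_space :: "nat \<Rightarrow> real \<Rightarrow> real \<Rightarrow> ((nat \<Rightarrow> real) \<Rightarrow> complex) set" where
  "X_space N p q = {f \<in> Lp_loc N p. X_norm N p q f < \<infinity>}"

definition cube_sup :: "nat \<Rightarrow> real \<Rightarrow> ((nat \<Rightarrow> real) \<Rightarrow> complex) \<Rightarrow> ennreal" where
  "cube_sup N p f =
    (SUP (j, k)\<in>UNIV \<times> int_points N.
       ennreal (2 powr (real_of_int j * (real N / 2) * (2 - p))) *
         (\<integral>\<^sup>+x\<in>cube N j k. ennreal (norm (f x) powr p) \<partial>leb N))"

text \<open>\<open>E\<close> is contained in \<open>F\<close> and the inclusion map is continuous for the given norms.\<close>

definition continuously_embedded ::
  "('a \<Rightarrow> complex) set \<Rightarrow> (('a \<Rightarrow> complex) \<Rightarrow> ennreal) \<Rightarrow>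
   ('a \<Rightarrow> complex) set \<Rightarrow> (('a \<Rightarrow> complex) \<Rightarrow> ennreal) \<Rightarrow> bool" where
  "continuously_embedded E normE F normF \<longleftrightarrow>
     E \<subseteq> F \<and>
     (\<forall>f\<in>E. \<forall>\<epsilon>>0::real. \<exists>\<delta>>0::real. \<forall>g\<in>E.
        normE (\<lambda>x. g x - f x) < ennreal \<delta> \<longrightarrow> normF (\<lambda>x. g x - f x) < ennreal \<epsilon>)"

end

theory Submission
  imports Defs
begin

text \<open>Write \<open>B\<^sub>j\<^sub>k\<close> for the integral of the \<open>p\<close>-th power of the modulus of \<open>f\<close> over the cube \<open>(j, k)\<close>, scaled by
\<open>2\<close> to the power \<open>j (N/2) (2 - p)\<close> (\<open>scaled_mass\<close>). The supremum in the theorem is the supremum \<open>S\<close>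
of the \<open>B\<^sub>j\<^sub>k\<close>, and the \<open>q\<close>-th power of the \<open>X\<close> norm is the sum of their powers with exponent \<open>q / p\<close>.
By Hoelder's inequality \<open>S\<close> is at most the \<open>p\<close>-th power of the \<open>L\<^sup>2\<close> norm \<open>\<theta>\<close>, which is the second inequality.

For the first one choose \<open>r\<close> with \<open>2 < r < q\<close>. As \<open>B\<^sub>j\<^sub>k \<le> S\<close>, it suffices to bound the sum of the
powers with exponent \<open>r / p\<close> by a multiple of \<open>\<theta>\<^sup>r\<close> (\<open>sum_scaled_mass_le\<close>); this gives
\<open>\<mu> = (q - r) / (p q)\<close>. At scale \<open>j\<close> the modulus is cut at height \<open>\<theta> 2\<^bsup>jN/2\<^esup>\<close>. For the large
values (\<open>sum_large_values_le\<close>) the inclusion of \<open>\<ell>\<^sup>1\<close> in \<open>\<ell>\<^bsup>r/p\<^esup>\<close>, where \<open>r / p > 1\<close>, reduces the claim to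
the sum of the masses, for the small values (\<open>sum_small_values_le\<close>) Hoelder's inequality reduces it
to integrals of \<open>r\<close>-th powers. In both cases one exchanges the sum over the scales and the integral;
what is left at each point is a geometric series which turns the exponent \<open>p\<close> or \<open>r\<close> into \<open>2\<close>. The
ratio of the series is at most that of dimension one, so the constant is independent of \<open>N\<close>.

The spaces differ because the sum \<open>spikes\<close> of the indicators of sparse unit cubes with heights
\<open>(n + 1)\<^bsup>-1/2\<^esup>\<close> is not square integrable, but has a finite \<open>X\<close> norm (\<open>spikes_sum_less_top\<close>): it lies in
\<open>L\<^sup>q\<close>, which controls the small cubes, and a large cube away from the origin sees at most one spike,
so that the sum over large cubes is controlled by the \<open>L\<^sup>q\<close> norm as well. The large cubes
near the origin see few spikes compared with the decay of the scaling.\<close>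

section \<open>Real powers of extended nonnegative numbers\<close>

lemma ennpow_ennreal: "0 \<le> x \<Longrightarrow> ennpow (ennreal x) a = ennreal (x powr a)"
  by (simp add: ennpow_def)

lemma ennpow_top [simp]: "ennpow top a = top"
  by (simp add: ennpow_def)

lemma ennpow_0 [simp]: "ennpow 0 a = 0"
  by (simp add: ennpow_def)

lemma ennpow_one [simp]: "ennpow x 1 = x"
  by (cases x) (auto simp: ennpow_ennreal)

lemma ennpow_less_top [simp]: "ennpow x a < top \<longleftrightarrow> x < top"
  by (cases x) (auto simp: ennpow_ennreal)

lemma ennpow_mono: "0 \<le> a \<Longrightarrow> x \<le> y \<Longrightarrow> ennpow x a \<le> ennpow y a"
  by (cases x; cases y) (auto simp: ennpow_ennreal top_unique intro!: ennreal_leI powr_mono2)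

lemma ennpow_eq_0 [simp]: "ennpow x a = 0 \<longleftrightarrow> x = 0"
  by (cases x) (auto simp: ennpow_ennreal)

lemma ennpow_mult: "ennpow (x * y) a = ennpow x a * ennpow y a"
proof (cases "x = 0 \<or> y = 0")
  case False
  then show ?thesis
    by (cases x; cases y)
      (auto simp: ennpow_ennreal powr_mult ennreal_mult_eq_top_iff simp flip: ennreal_mult'')
qed auto

lemma ennpow_ennpow: "ennpow (ennpow x a) b = ennpow x (a * b)"
  by (cases x) (auto simp: ennpow_ennreal powr_powr)

lemma ennpow_add: "ennpow x (a + b) = ennpow x a * ennpow x b"
  by (cases x) (auto simp: ennpow_ennreal powr_add ennreal_mult)

lemma ennpow_add_le:
  assumes "0 \<le> a"
  shows "ennpow (x + y) a \<le> ennreal (2 powr a) * (ennpow x a + ennpow y a)"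
proof -
  have "x + y \<le> ennreal 2 * max x y"
    by (simp add: add_mono mult_2)
  then have "ennpow (x + y) a \<le> ennpow (ennreal 2 * max x y) a"
    by (rule ennpow_mono[OF assms])
  also have "\<dots> = ennreal (2 powr a) * ennpow (max x y) a"
    by (simp only: ennpow_mult) (simp add: ennpow_ennreal del: ennreal_numeral)
  also have "\<dots> \<le> ennreal (2 powr a) * (ennpow x a + ennpow y a)"
    by (intro mult_left_mono) (auto simp: max_def)
  finally show ?thesis .
qed

section \<open>Sums of extended nonnegative numbers\<close>

lemma sum_le_nn_integral_count_space:
  fixes g :: "'a \<Rightarrow> ennreal"
  assumes "finite F" "F \<subseteq> I"
  shows "sum g F \<le> (\<integral>\<^sup>+i. g i \<partial>count_space I)"
proof -
  have "sum g F = (\<integral>\<^sup>+i. g i \<partial>count_space F)"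
    using assms by (simp add: nn_integral_count_space_finite)
  also have "\<dots> = (\<integral>\<^sup>+i. g i * indicator F i \<partial>count_space I)"
    using assms
    by (simp add: nn_integral_restrict_space[symmetric] restrict_count_space Int_absorb1 Int_absorb2)
  also have "\<dots> \<le> (\<integral>\<^sup>+i. g i \<partial>count_space I)"
    by (intro nn_integral_mono) (auto simp: indicator_def)
  finally show ?thesis .
qed

lemma le_nn_integral_count_space: "i \<in> I \<Longrightarrow> g i \<le> (\<integral>\<^sup>+i. g i \<partial>count_space I)"
  using sum_le_nn_integral_count_space[of "{i}" I g] by simp

text \<open>Only upper bounds for \<open>X_norm\<close> are ever required, so this inequality suffices to trade its
unordered sums for integrals over counting measure, where Fubini's theorem is at hand.\<close>

lemma infsum_le_nn_integral:
  fixes g :: "'a \<Rightarrow> ennreal"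
  shows "(\<Sum>\<^sub>\<infinity>i\<in>I. g i) \<le> (\<integral>\<^sup>+i. g i \<partial>count_space I)"
  by (rule infsum_le_finite_sums) (auto intro: nonneg_summable_on_complete sum_le_nn_integral_count_space)

text \<open>Superadditivity of \<open>t \<mapsto> t\<^sup>s\<close>, that is, the inclusion of \<open>\<ell>\<^sup>1\<close> in \<open>\<ell>\<^sup>s\<close>: each term is at most the total
\<open>G\<close>, so its \<open>s\<close>-th power is at most the term times \<open>G\<close> to the power \<open>s - 1\<close>.\<close>

lemma sum_ennpow_le:
  assumes "1 < s"
  shows "(\<integral>\<^sup>+i. ennpow (g i) s \<partial>count_space I) \<le> ennpow (\<integral>\<^sup>+i. g i \<partial>count_space I) s"
proof -
  let ?G = "\<integral>\<^sup>+i. g i \<partial>count_space I"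
  have "(\<integral>\<^sup>+i. ennpow (g i) s \<partial>count_space I) \<le> (\<integral>\<^sup>+i. g i * ennpow ?G (s - 1) \<partial>count_space I)"
  proof (rule nn_integral_mono)
    fix i assume "i \<in> space (count_space I)"
    then have "g i \<le> ?G"
      by (intro le_nn_integral_count_space) simp
    have "ennpow (g i) s = g i * ennpow (g i) (s - 1)"
      using ennpow_add[of "g i" 1 "s - 1"] by simp
    also have "\<dots> \<le> g i * ennpow ?G (s - 1)"
      using \<open>1 < s\<close> \<open>g i \<le> ?G\<close> by (intro mult_left_mono ennpow_mono) auto
    finally show "ennpow (g i) s \<le> g i * ennpow ?G (s - 1)" .
  qed
  also have "\<dots> = ?G * ennpow ?G (s - 1)"
    by (simp add: nn_integral_multc)
  also have "\<dots> = ennpow ?G s"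
    using ennpow_add[of ?G 1 "s - 1"] by simp
  finally show ?thesis .
qed

section \<open>Geometric sums over the dyadic scales\<close>

text \<open>With \<open>L\<close> the integer part of the base-\<open>b\<close> logarithm of \<open>y\<close>, the scales \<open>j \<le> L\<close> are exactly those that
count, and the sum is a geometric series with leading term at most \<open>y\<^sup>\<alpha>\<close>.\<close>

lemma sum_geometric_below:
  fixes b \<alpha> y :: real
  assumes "1 < b" "0 < \<alpha>" "0 < y"
  shows "(\<integral>\<^sup>+j. ennreal (b powr (of_int j * \<alpha>)) * indicator {j. b powr of_int j \<le> y} j \<partial>count_space (UNIV :: int set))
    \<le> ennreal (y powr \<alpha> / (1 - b powr - \<alpha>))"
proof -
  define L where "L = \<lfloor>log b y\<rfloor>"
  have iff: "b powr of_int j \<le> y \<longleftrightarrow> j \<le> L" for j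
    using assms by (simp add: L_def le_floor_iff powr_le_iff)
  have bij: "bij_betw (\<lambda>n. L - int n) UNIV {..L}"
    by (rule bij_betwI[where g = "\<lambda>j. nat (L - j)"]) auto
  have r: "0 < b powr - \<alpha>" "b powr - \<alpha> < 1"
    using assms by (auto simp: powr_less_one)
  have "(\<integral>\<^sup>+j. ennreal (b powr (of_int j * \<alpha>)) * indicator {j. b powr of_int j \<le> y} j \<partial>count_space (UNIV :: int set))
    = (\<integral>\<^sup>+j. ennreal (b powr (of_int j * \<alpha>)) \<partial>count_space {..L})"
    unfolding iff by (subst nn_integral_restrict_space[symmetric]) (auto simp: restrict_count_space atMost_def)
  also have "\<dots> = (\<Sum>n. ennreal (b powr (of_int (L - int n) * \<alpha>)))"
    by (subst nn_integral_bij_count_space[OF bij, symmetric]) (simp add: nn_integral_count_space_nat)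
  also have "\<dots> = (\<Sum>n. ennreal (b powr (L * \<alpha>) * (b powr - \<alpha>) ^ n))"
    using assms by (intro suminf_cong arg_cong[where f = ennreal])
      (simp add: powr_power powr_add[symmetric] algebra_simps)
  also have "\<dots> = ennreal (\<Sum>n. b powr (L * \<alpha>) * (b powr - \<alpha>) ^ n)"
    using r by (intro suminf_ennreal2) (auto intro!: summable_mult summable_geometric)
  also have "(\<Sum>n. b powr (L * \<alpha>) * (b powr - \<alpha>) ^ n) = b powr (L * \<alpha>) / (1 - b powr - \<alpha>)"
    using r by (simp add: suminf_mult suminf_geometric summable_geometric)
  also have "b powr (L * \<alpha>) \<le> y powr \<alpha>"
    using assms iff[of L] by (auto simp: powr_powr[symmetric] intro!: powr_mono2)
  finally show ?thesis
    using r by (auto simp: divide_right_mono ennreal_leI elim!: order.trans)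
qed

text \<open>This is the value for ratio \<open>2\<^bsup>-\<alpha>/2\<^esup>\<close>, the worst one: in dimension \<open>d\<close> the ratio is
\<open>2\<^bsup>-d\<alpha>/2\<^esup>\<close>. Fixing it here keeps every later constant independent of the dimension.\<close>

definition geo_const :: "real \<Rightarrow> real" where
  "geo_const \<alpha> = 1 / (1 - 2 powr (- \<alpha> / 2))"

lemma geo_const_pos: "0 < \<alpha> \<Longrightarrow> 0 < geo_const \<alpha>"
  by (simp add: geo_const_def powr_less_one)

lemma sum_dyadic_below:
  fixes d \<alpha> y :: real
  assumes "1 \<le> d" "0 < \<alpha>" "0 \<le> y"
  shows "(\<integral>\<^sup>+j. ennreal (2 powr (of_int j * (d / 2) * \<alpha>)) * indicator {j. 2 powr (of_int j * (d / 2)) \<le> y} j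
      \<partial>count_space (UNIV :: int set)) \<le> ennreal (geo_const \<alpha> * y powr \<alpha>)"
proof (cases "y = 0")
  case False
  define b :: real where "b = 2 powr (d / 2)"
  have b: "1 < b" using assms by (simp add: b_def)
  have "2 powr (of_int j * (d / 2)) = b powr of_int j"
    "2 powr (of_int j * (d / 2) * \<alpha>) = b powr (of_int j * \<alpha>)" for j :: int
    by (simp_all add: b_def powr_powr mult_ac)
  then have "(\<integral>\<^sup>+j. ennreal (2 powr (of_int j * (d / 2) * \<alpha>)) * indicator {j. 2 powr (of_int j * (d / 2)) \<le> y} j
      \<partial>count_space (UNIV :: int set)) \<le> ennreal (y powr \<alpha> / (1 - b powr - \<alpha>))"
    using sum_geometric_below[OF b, of \<alpha> y] assms False by simp
  also have "\<dots> \<le> ennreal (geo_const \<alpha> * y powr \<alpha>)"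
  proof (rule ennreal_leI)
    have 1: "b powr - \<alpha> \<le> 2 powr (- \<alpha> / 2)"
      using assms by (simp add: b_def powr_powr)
    have 2: "2 powr (- \<alpha> / 2) < 1"
      using assms by (simp add: powr_less_one)
    have "y powr \<alpha> / (1 - b powr - \<alpha>) \<le> y powr \<alpha> / (1 - 2 powr (- \<alpha> / 2))"
      using 1 2 by (intro divide_left_mono mult_pos_pos) (simp; linarith)+
    then show "y powr \<alpha> / (1 - b powr - \<alpha>) \<le> geo_const \<alpha> * y powr \<alpha>"
      by (simp add: geo_const_def)
  qed
  finally show ?thesis .
qed simp

text \<open>The reflection \<open>j \<mapsto> -j\<close> turns large scales into small ones.\<close>

lemma sum_dyadic_above:
  fixes d \<alpha> y :: real
  assumes "1 \<le> d" "0 < \<alpha>" "0 < y"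
  shows "(\<integral>\<^sup>+j. ennreal (2 powr - (of_int j * (d / 2) * \<alpha>)) * indicator {j. y \<le> 2 powr (of_int j * (d / 2))} j
      \<partial>count_space (UNIV :: int set)) \<le> ennreal (geo_const \<alpha> * y powr - \<alpha>)"
proof -
  have iff: "2 powr (of_int (- j) * (d / 2)) \<le> 1 / y \<longleftrightarrow> y \<le> 2 powr (of_int j * (d / 2))" for j :: int
    using assms by (simp add: powr_minus field_simps)
  have "(\<integral>\<^sup>+j. ennreal (2 powr - (of_int j * (d / 2) * \<alpha>)) * indicator {j. y \<le> 2 powr (of_int j * (d / 2))} j
      \<partial>count_space (UNIV :: int set)) =
    (\<integral>\<^sup>+j. ennreal (2 powr (of_int (- j) * (d / 2) * \<alpha>)) *
      indicator {j. 2 powr (of_int j * (d / 2)) \<le> 1 / y} (- j) \<partial>count_space (UNIV :: int set))"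
    by (intro nn_integral_cong) (simp add: iff[simplified] indicator_def)
  also have "\<dots> = (\<integral>\<^sup>+j. ennreal (2 powr (of_int j * (d / 2) * \<alpha>)) *
      indicator {j. 2 powr (of_int j * (d / 2)) \<le> 1 / y} j \<partial>count_space (UNIV :: int set))"
    by (rule nn_integral_bij_count_space[OF bij_uminus])
  also have "\<dots> \<le> ennreal (geo_const \<alpha> * (1 / y) powr \<alpha>)"
    using assms by (intro sum_dyadic_below) auto
  also have "(1 / y) powr \<alpha> = y powr - \<alpha>"
    using assms by (simp add: powr_divide powr_minus_divide)
  finally show ?thesis .
qed

section \<open>Hoelder's inequality on a set of bounded measure\<close>

text \<open>The convex function \<open>w \<mapsto> w\<^sup>s\<close> lies above its tangent at \<open>m\<close>. Young's inequality is exactly this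
after division by \<open>s\<close>.\<close>

lemma tangent_powr:
  fixes w m s :: real
  assumes "1 < s" "0 \<le> w" "0 < m"
  shows "s * m powr (s - 1) * w \<le> w powr s + (s - 1) * m powr s"
proof (cases "w = 0")
  case False
  have "(w powr s) powr (1 / s) * (m powr s) powr (1 - 1 / s) \<le> (1 / s) * w powr s + (1 - 1 / s) * m powr s"
    using assms False by (intro Youngs_inequality_0) (auto simp: field_simps)
  also have "(w powr s) powr (1 / s) * (m powr s) powr (1 - 1 / s) = w * m powr (s - 1)"
    using assms False by (simp add: powr_powr right_diff_distrib)
  finally have "s * (w * m powr (s - 1)) \<le> s * ((1 / s) * w powr s + (1 - 1 / s) * m powr s)"
    using assms by (intro mult_left_mono) auto
  then show ?thesis
    using assms by (simp add: algebra_simps)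
qed (use assms in \<open>simp add: mult_nonneg_nonneg\<close>)

text \<open>Jensen's inequality by integrating the tangent line at the mean value \<open>m\<close>. The constant has to be
the sharp one: the bound of the interpolated quantity by the \<open>L\<^sup>2\<close> norm leaves no room for another.\<close>

lemma ennpow_nn_integral_le:
  fixes w :: "'a \<Rightarrow> real"
  assumes "1 < s" and nn: "\<And>x. 0 \<le> w x" and "0 < a"
    and [measurable]: "w \<in> borel_measurable M" "A \<in> sets M"
    and A: "emeasure M A \<le> ennreal a"
  shows "ennpow (\<integral>\<^sup>+x\<in>A. ennreal (w x) \<partial>M) s
    \<le> ennreal (a powr (s - 1)) * (\<integral>\<^sup>+x\<in>A. ennreal (w x powr s) \<partial>M)"
    (is "ennpow ?I s \<le> _ * ?J")
proof (cases ?J)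
  case top
  then show ?thesis using \<open>0 < a\<close> by simp
next
  case (real J)
  \<comment> \<open>Finiteness of the integral is needed before its mean value can serve as a real tangent point.\<close>
  have "?I \<le> (\<integral>\<^sup>+x. indicator A x + ennreal (w x powr s) * indicator A x \<partial>M)"
  proof (rule nn_integral_mono)
    fix x
    have "w x \<le> 1 + w x powr s"
    proof (cases "w x \<le> 1")
      case True
      then show ?thesis using powr_ge_zero[of "w x" s] by linarith
    next
      case False
      then show ?thesis using \<open>1 < s\<close> powr_mono[of 1 s "w x"] by simp
    qed
    then have "ennreal (w x) \<le> ennreal (1 + w x powr s)"
      by (rule ennreal_leI)
    then show "ennreal (w x) * indicator A x \<le> indicator A x + ennreal (w x powr s) * indicator A x"
      by (auto simp: indicator_def)
  qed
  also have "\<dots> = emeasure M A + ?J"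
    by (subst nn_integral_add) auto
  also have "\<dots> < top"
    using A real by (auto simp: less_top[symmetric] top_unique)
  finally obtain I where I: "?I = ennreal I" "0 \<le> I"
    by (cases ?I) auto
  show ?thesis
  proof (cases "I = 0")
    case False
    define m where "m = I / a"
    have "0 < m" using False I \<open>0 < a\<close> by (simp add: m_def)
    have "I = m * a" using \<open>0 < a\<close> by (simp add: m_def)
    have "ennreal (s * m powr (s - 1)) * ?I = (\<integral>\<^sup>+x\<in>A. ennreal (s * m powr (s - 1) * w x) \<partial>M)"
      using \<open>1 < s\<close> nn
      by (subst nn_integral_cmult[symmetric]) (auto simp: ennreal_mult' mult_ac)
    also have "\<dots> \<le> (\<integral>\<^sup>+x. ennreal (w x powr s) * indicator A x + ennreal ((s - 1) * m powr s) * indicator A x \<partial>M)"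
    proof (rule nn_integral_mono)
      fix x
      show "ennreal (s * m powr (s - 1) * w x) * indicator A x
        \<le> ennreal (w x powr s) * indicator A x + ennreal ((s - 1) * m powr s) * indicator A x"
        using tangent_powr[OF \<open>1 < s\<close> nn[of x] \<open>0 < m\<close>] \<open>1 < s\<close>
        by (auto simp: indicator_def simp flip: ennreal_plus intro!: ennreal_leI)
    qed
    also have "\<dots> = ?J + ennreal ((s - 1) * m powr s) * emeasure M A"
      by (subst nn_integral_add) (auto simp: nn_integral_cmult)
    also have "\<dots> \<le> ?J + ennreal ((s - 1) * m powr s) * ennreal a"
      using A by (intro add_left_mono mult_left_mono) auto
    finally have upper: "s * m powr (s - 1) * I \<le> J + (s - 1) * m powr s * a"
      using I real \<open>1 < s\<close> \<open>0 < a\<close> by (simp flip: ennreal_mult ennreal_plus)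
    have "m powr (s - 1) * I = m powr s * a"
      using \<open>0 < m\<close> by (simp add: powr_diff \<open>I = m * a\<close>)
    then have eq: "s * m powr (s - 1) * I = s * (m powr s * a)"
      by (simp add: mult.assoc)
    have le: "m powr s * a \<le> J"
      using upper unfolding eq by (simp add: algebra_simps)
    have "I powr s = a powr (s - 1) * (m powr s * a)"
      using False I \<open>0 < a\<close> by (simp add: m_def powr_divide powr_diff)
    also have "\<dots> \<le> a powr (s - 1) * J"
      using le by (intro mult_left_mono) auto
    finally show ?thesis
      using I real by (simp add: ennpow_ennreal flip: ennreal_mult)
  qed (use I in simp)
qed

section \<open>Dyadic cubes\<close>

lemma countable_int_points: "countable (int_points N)"
  by (simp add: int_points_def countable_PiE)

lemma PiE_sets_leb: "(\<And>i. i \<in> {1..N} \<Longrightarrow> A i \<in> sets borel) \<Longrightarrow> Pi\<^sub>E {1..N} A \<in> sets (leb N)"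
  unfolding leb_def by (intro sets_completionI_sets sets_PiM_I_finite) auto

lemma emeasure_leb_PiE:
  assumes "\<And>i. i \<in> {1..N} \<Longrightarrow> A i \<in> sets borel"
  shows "emeasure (leb N) (Pi\<^sub>E {1..N} A) = (\<Prod>i\<in>{1..N}. emeasure lborel (A i))"
proof -
  interpret product_sigma_finite "\<lambda>_::nat. lborel :: real measure"
    by unfold_locales
  show ?thesis
    unfolding leb_def using assms
    by (subst emeasure_completion) (auto intro!: sets_PiM_I_finite emeasure_PiM)
qed

lemma sets_cube [measurable]: "cube N j k \<in> sets (leb N)"
  unfolding cube_def by (rule PiE_sets_leb) simp

lemma emeasure_cube: "emeasure (leb N) (cube N j k) = ennreal (2 powr - (of_int j * real N))"
proof -
  have "emeasure lborel {real_of_int (k m) * 2 powi (- j) ..< (real_of_int (k m) + 1) * 2 powi (- j)}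
      = ennreal (2 powr - of_int j)" for m
    using powr_real_of_int'[of 2 "- j"] by (simp add: algebra_simps)
  then have "emeasure (leb N) (cube N j k) = ennreal (2 powr - of_int j) ^ N"
    unfolding cube_def by (subst emeasure_leb_PiE) auto
  also have "\<dots> = ennreal (2 powr - (of_int j * real N))"
    by (simp add: ennreal_power powr_power mult.commute)
  finally show ?thesis .
qed

text \<open>A cube is recovered from any of its points, which gives disjointness at a fixed scale.\<close>

lemma cube_eq_floor:
  assumes "x \<in> cube N j k" "m \<in> {1..N}"
  shows "k m = \<lfloor>x m * 2 powi j\<rfloor>"
proof -
  have "real_of_int (k m) * 2 powi (- j) \<le> x m" "x m < (real_of_int (k m) + 1) * 2 powi (- j)"
    using assms by (auto simp: cube_def PiE_iff)
  then have "real_of_int (k m) \<le> x m * 2 powi j" "x m * 2 powi j < real_of_int (k m) + 1"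
    by (auto simp: power_int_minus field_simps)
  then show ?thesis
    by linarith
qed

lemma cube_disjoint:
  assumes "x \<in> cube N j k" "x \<in> cube N j l" "k \<in> int_points N" "l \<in> int_points N"
  shows "k = l"
  using assms(3,4) cube_eq_floor[OF assms(1)] cube_eq_floor[OF assms(2)]
  unfolding int_points_def by (intro PiE_ext) auto

lemma sum_cubes_le:
  assumes [measurable]: "g \<in> borel_measurable (leb N)"
  shows "(\<integral>\<^sup>+k. (\<integral>\<^sup>+x\<in>cube N j k. g x \<partial>leb N) \<partial>count_space (int_points N)) \<le> (\<integral>\<^sup>+x. g x \<partial>leb N)"
proof -
  have "(\<integral>\<^sup>+k. (\<integral>\<^sup>+x\<in>cube N j k. g x \<partial>leb N) \<partial>count_space (int_points N))
      = (\<integral>\<^sup>+x. (\<integral>\<^sup>+k. g x * indicator (cube N j k) x \<partial>count_space (int_points N)) \<partial>leb N)"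
    using countable_int_points by (intro nn_integral_count_space_nn_integral[symmetric]) auto
  also have "\<dots> \<le> (\<integral>\<^sup>+x. g x \<partial>leb N)"
  proof (rule nn_integral_mono)
    fix x
    show "(\<integral>\<^sup>+k. g x * indicator (cube N j k) x \<partial>count_space (int_points N)) \<le> g x"
    proof (cases "\<exists>k\<in>int_points N. x \<in> cube N j k")
      case True
      then obtain k where k: "k \<in> int_points N" "x \<in> cube N j k" by auto
      then have only: "x \<in> cube N j l \<longleftrightarrow> l = k" if "l \<in> int_points N" for l
        using that cube_disjoint by blast
      have "(\<integral>\<^sup>+l. g x * indicator (cube N j l) x \<partial>count_space (int_points N))
          = (\<integral>\<^sup>+l. g x * indicator {k} l \<partial>count_space (int_points N))"
        by (intro nn_integral_cong) (simp add: indicator_def only)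
      also have "\<dots> = g x"
        using k by (simp add: nn_integral_cmult_indicator)
      finally show ?thesis by simp
    next
      case False
      then have "(\<integral>\<^sup>+k. g x * indicator (cube N j k) x \<partial>count_space (int_points N))
          = (\<integral>\<^sup>+k. 0 \<partial>count_space (int_points N))"
        by (intro nn_integral_cong) auto
      then show ?thesis by simp
    qed
  qed
  finally show ?thesis .
qed

section \<open>Scaled masses of cubes\<close>

text \<open>The scaling makes the masses invariant under the dyadic dilations that preserve the \<open>L\<^sup>2\<close> norm.
The supremum in the theorem is the supremum of these masses, and \<open>X_norm\<close> is the \<open>p\<close>-th root of
the \<open>\<ell>\<^bsup>q/p\<^esup>\<close> norm of their family.\<close>

definition scaled_mass :: "nat \<Rightarrow> real \<Rightarrow> int \<Rightarrow> (nat \<Rightarrow> int) \<Rightarrow> ((nat \<Rightarrow> real) \<Rightarrow> real) \<Rightarrow> ennreal" where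
  "scaled_mass N p j k u =
     ennreal (2 powr (of_int j * (real N / 2) * (2 - p))) * (\<integral>\<^sup>+x\<in>cube N j k. ennreal (u x powr p) \<partial>leb N)"

text \<open>Hoelder's inequality from \<open>L\<^sup>p\<close> to \<open>L\<^sup>r\<close> on a cube. Because of the scaling the exponent \<open>p\<close>
disappears from the power of two, which is decreasing in \<open>j\<close> for \<open>r > 2\<close> and is \<open>1\<close> for \<open>r = 2\<close>.\<close>

lemma scaled_mass_powr_le:
  assumes p: "0 < p" "p < r" and [measurable]: "u \<in> borel_measurable (leb N)"
  shows "ennpow (scaled_mass N p j k u) (r / p)
    \<le> ennreal (2 powr - (of_int j * (real N / 2) * (r - 2))) * (\<integral>\<^sup>+x\<in>cube N j k. ennreal (u x powr r) \<partial>leb N)"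
proof -
  let ?e = "of_int j * (real N / 2)"
  have "ennpow (scaled_mass N p j k u) (r / p)
    = ennreal ((2 powr (?e * (2 - p))) powr (r / p)) * ennpow (\<integral>\<^sup>+x\<in>cube N j k. ennreal (u x powr p) \<partial>leb N) (r / p)"
    by (simp add: scaled_mass_def ennpow_mult ennpow_ennreal)
  also have "ennpow (\<integral>\<^sup>+x\<in>cube N j k. ennreal (u x powr p) \<partial>leb N) (r / p)
      \<le> ennreal ((2 powr - (of_int j * real N)) powr (r / p - 1)) * (\<integral>\<^sup>+x\<in>cube N j k. ennreal ((u x powr p) powr (r / p)) \<partial>leb N)"
    using p by (intro ennpow_nn_integral_le) (auto simp: emeasure_cube)
  also have "(\<integral>\<^sup>+x\<in>cube N j k. ennreal ((u x powr p) powr (r / p)) \<partial>leb N) = (\<integral>\<^sup>+x\<in>cube N j k. ennreal (u x powr r) \<partial>leb N)"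
    using p by (simp add: powr_powr)
  finally have "ennpow (scaled_mass N p j k u) (r / p) \<le> ennreal ((2 powr (?e * (2 - p))) powr (r / p)) *
    (ennreal ((2 powr - (of_int j * real N)) powr (r / p - 1)) * (\<integral>\<^sup>+x\<in>cube N j k. ennreal (u x powr r) \<partial>leb N))"
    by (simp add: mult_left_mono)
  also have "\<dots> = ennreal ((2 powr (?e * (2 - p))) powr (r / p) * (2 powr - (of_int j * real N)) powr (r / p - 1)) *
    (\<integral>\<^sup>+x\<in>cube N j k. ennreal (u x powr r) \<partial>leb N)"
    by (simp add: ennreal_mult' mult_ac)
  also have "(2 powr (?e * (2 - p))) powr (r / p) * (2 powr - (of_int j * real N)) powr (r / p - 1)
    = 2 powr (?e * (2 - p) * (r / p) - of_int j * real N * (r / p - 1))"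
    by (simp add: powr_powr flip: powr_add)
  also have "?e * (2 - p) * (r / p) - of_int j * real N * (r / p - 1) = - (?e * (r - 2))"
    using p by (simp add: field_simps)
  finally show ?thesis .
qed

lemma scaled_mass_le:
  assumes p: "0 < p" "p < 2" and [measurable]: "u \<in> borel_measurable (leb N)"
  shows "scaled_mass N p j k u \<le> ennpow (\<integral>\<^sup>+x. ennreal (u x powr 2) \<partial>leb N) (p / 2)"
proof -
  have "scaled_mass N p j k u = ennpow (ennpow (scaled_mass N p j k u) (2 / p)) (p / 2)"
    using p by (simp add: ennpow_ennpow)
  also have "\<dots> \<le> ennpow (\<integral>\<^sup>+x. ennreal (u x powr 2) \<partial>leb N) (p / 2)"
  proof (rule ennpow_mono)
    have "ennpow (scaled_mass N p j k u) (2 / p) \<le> (\<integral>\<^sup>+x\<in>cube N j k. ennreal (u x powr 2) \<partial>leb N)"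
      using scaled_mass_powr_le[OF p, of u N j k] by simp
    also have "\<dots> \<le> (\<integral>\<^sup>+x. ennreal (u x powr 2) \<partial>leb N)"
      by (intro nn_integral_mono) (auto simp: indicator_def)
    finally show "ennpow (scaled_mass N p j k u) (2 / p) \<le> (\<integral>\<^sup>+x. ennreal (u x powr 2) \<partial>leb N)" .
  qed (use p in simp)
  finally show ?thesis .
qed

lemma sum_scaled_mass_powr_le:
  assumes p: "0 < p" "p < r" and [measurable]: "u \<in> borel_measurable (leb N)"
  shows "(\<integral>\<^sup>+k. ennpow (scaled_mass N p j k u) (r / p) \<partial>count_space (int_points N))
    \<le> ennreal (2 powr - (of_int j * (real N / 2) * (r - 2))) * (\<integral>\<^sup>+x. ennreal (u x powr r) \<partial>leb N)"
proof -
  have "(\<integral>\<^sup>+k. ennpow (scaled_mass N p j k u) (r / p) \<partial>count_space (int_points N))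
    \<le> (\<integral>\<^sup>+k. ennreal (2 powr - (of_int j * (real N / 2) * (r - 2))) *
        (\<integral>\<^sup>+x\<in>cube N j k. ennreal (u x powr r) \<partial>leb N) \<partial>count_space (int_points N))"
    using assms by (intro nn_integral_mono scaled_mass_powr_le)
  also have "\<dots> = ennreal (2 powr - (of_int j * (real N / 2) * (r - 2))) *
      (\<integral>\<^sup>+k. (\<integral>\<^sup>+x\<in>cube N j k. ennreal (u x powr r) \<partial>leb N) \<partial>count_space (int_points N))"
    by (simp add: nn_integral_cmult)
  also have "\<dots> \<le> ennreal (2 powr - (of_int j * (real N / 2) * (r - 2))) * (\<integral>\<^sup>+x. ennreal (u x powr r) \<partial>leb N)"
    by (intro mult_left_mono sum_cubes_le) auto
  finally show ?thesis .
qed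

section \<open>Summability of the masses of a square integrable function\<close>

lemma powr_mult_powr_divide:
  fixes u \<theta> a c :: real
  assumes "0 < u" "0 < \<theta>"
  shows "u powr a * (u / \<theta>) powr (c - a) = \<theta> powr (a - c) * u powr c"
proof -
  have "\<theta> powr (a - c) = 1 / \<theta> powr (c - a)"
    using powr_minus_divide[of \<theta> "c - a"] by simp
  then show ?thesis
    using assms by (simp add: powr_divide flip: powr_add)
qed

text \<open>Where \<open>u\<close> exceeds the threshold of the scale, the masses themselves are summable over all cubes of
all scales, and \<open>\<ell>\<^sup>1\<close> sits inside \<open>\<ell>\<^bsup>r/p\<^esup>\<close>. Indeed after exchanging sum and integral a point
\<open>x\<close> only meets the scales below \<open>u x / \<theta>\<close>, and their weights add up to a multiple of the
\<open>(2 - p)\<close>-th power of this quotient, which completes the \<open>p\<close>-th power of \<open>u x\<close> to the square.\<close>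

lemma sum_large_values_le:
  assumes N: "1 \<le> N" and p: "0 < p" "p < 2" "p < r" and "0 < \<theta>"
    and [measurable]: "u \<in> borel_measurable (leb N)" and nn: "\<And>x. 0 \<le> u x"
  shows "(\<integral>\<^sup>+j. (\<integral>\<^sup>+k. ennpow (scaled_mass N p j k
      (\<lambda>x. u x * indicator {x. \<theta> * 2 powr (of_int j * (real N / 2)) \<le> u x} x)) (r / p)
      \<partial>count_space (int_points N)) \<partial>count_space UNIV)
    \<le> ennpow (ennreal (geo_const (2 - p) * \<theta> powr (p - 2)) * (\<integral>\<^sup>+x. ennreal (u x powr 2) \<partial>leb N)) (r / p)"
proof -
  define v where "v j x = u x * indicator {x. \<theta> * 2 powr (of_int j * (real N / 2)) \<le> u x} x" for j :: int and x
  have [measurable]: "v j \<in> borel_measurable (leb N)" for j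
    unfolding v_def by measurable
  define w where "w j = ennreal (2 powr (of_int j * (real N / 2) * (2 - p)))" for j :: int
  have s: "1 < r / p" using p by simp
  have "(\<integral>\<^sup>+j. (\<integral>\<^sup>+k. ennpow (scaled_mass N p j k (v j)) (r / p) \<partial>count_space (int_points N)) \<partial>count_space UNIV)
    \<le> (\<integral>\<^sup>+j. ennpow (\<integral>\<^sup>+k. scaled_mass N p j k (v j) \<partial>count_space (int_points N)) (r / p) \<partial>count_space UNIV)"
    by (intro nn_integral_mono sum_ennpow_le s)
  also have "\<dots> \<le> ennpow (\<integral>\<^sup>+j. (\<integral>\<^sup>+k. scaled_mass N p j k (v j) \<partial>count_space (int_points N)) \<partial>count_space UNIV) (r / p)"
    by (intro sum_ennpow_le s)
  also have "\<dots> \<le> ennpow (\<integral>\<^sup>+j. w j * (\<integral>\<^sup>+x. ennreal (v j x powr p) \<partial>leb N) \<partial>count_space UNIV) (r / p)"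
    using s unfolding scaled_mass_def w_def
    by (intro ennpow_mono nn_integral_mono) (auto simp: nn_integral_cmult intro!: mult_left_mono sum_cubes_le)
  finally have norms: "(\<integral>\<^sup>+j. (\<integral>\<^sup>+k. ennpow (scaled_mass N p j k (v j)) (r / p) \<partial>count_space (int_points N)) \<partial>count_space UNIV)
    \<le> ennpow (\<integral>\<^sup>+j. w j * (\<integral>\<^sup>+x. ennreal (v j x powr p) \<partial>leb N) \<partial>count_space UNIV) (r / p)" .
  have "(\<integral>\<^sup>+j. w j * (\<integral>\<^sup>+x. ennreal (v j x powr p) \<partial>leb N) \<partial>count_space UNIV)
    = (\<integral>\<^sup>+x. (\<integral>\<^sup>+j. w j * ennreal (v j x powr p) \<partial>count_space UNIV) \<partial>leb N)"
    by (subst nn_integral_count_space_nn_integral) (auto simp: nn_integral_cmult)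
  also have "\<dots> \<le> (\<integral>\<^sup>+x. ennreal (geo_const (2 - p) * \<theta> powr (p - 2)) * ennreal (u x powr 2) \<partial>leb N)"
  proof (rule nn_integral_mono)
    fix x
    have "(\<integral>\<^sup>+j. w j * ennreal (v j x powr p) \<partial>count_space UNIV)
      = (\<integral>\<^sup>+j. ennreal (u x powr p) * (w j * indicator {j. 2 powr (of_int j * (real N / 2)) \<le> u x / \<theta>} j) \<partial>count_space UNIV)"
      using \<open>0 < \<theta>\<close> by (intro nn_integral_cong) (auto simp: v_def indicator_def field_simps)
    also have "\<dots> = ennreal (u x powr p) * (\<integral>\<^sup>+j. w j * indicator {j. 2 powr (of_int j * (real N / 2)) \<le> u x / \<theta>} j \<partial>count_space UNIV)"
      by (simp add: nn_integral_cmult)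
    also have "\<dots> \<le> ennreal (u x powr p) * ennreal (geo_const (2 - p) * (u x / \<theta>) powr (2 - p))"
      unfolding w_def using N p nn[of x] \<open>0 < \<theta>\<close> by (intro mult_left_mono sum_dyadic_below) auto
    also have "\<dots> = ennreal (u x powr p * (geo_const (2 - p) * (u x / \<theta>) powr (2 - p)))"
      by (simp add: ennreal_mult')
    also have "u x powr p * (geo_const (2 - p) * (u x / \<theta>) powr (2 - p)) = geo_const (2 - p) * \<theta> powr (p - 2) * u x powr 2"
      using powr_mult_powr_divide[of "u x" \<theta> p 2] nn[of x] \<open>0 < \<theta>\<close> p by (cases "u x = 0") auto
    also have "ennreal \<dots> = ennreal (geo_const (2 - p) * \<theta> powr (p - 2)) * ennreal (u x powr 2)"
      by (rule ennreal_mult'') simp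
    finally show "(\<integral>\<^sup>+j. w j * ennreal (v j x powr p) \<partial>count_space UNIV)
      \<le> ennreal (geo_const (2 - p) * \<theta> powr (p - 2)) * ennreal (u x powr 2)" .
  qed
  also have "\<dots> = ennreal (geo_const (2 - p) * \<theta> powr (p - 2)) * (\<integral>\<^sup>+x. ennreal (u x powr 2) \<partial>leb N)"
    by (simp add: nn_integral_cmult)
  finally show ?thesis
    using norms s unfolding v_def by (elim order.trans) (intro ennpow_mono, auto)
qed

text \<open>Below the threshold Hoelder's inequality replaces \<open>p\<close> by \<open>r\<close>. Now a point meets the scales above
\<open>u x / \<theta>\<close> with weights that decrease in the scale, and the geometric sum lowers the exponent \<open>r\<close>
to \<open>2\<close>.\<close>

lemma sum_small_values_le:
  assumes N: "1 \<le> N" and p: "0 < p" "p < r" "2 < r" and "0 < \<theta>"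
    and [measurable]: "u \<in> borel_measurable (leb N)" and nn: "\<And>x. 0 \<le> u x"
  shows "(\<integral>\<^sup>+j. (\<integral>\<^sup>+k. ennpow (scaled_mass N p j k
      (\<lambda>x. u x * indicator {x. u x < \<theta> * 2 powr (of_int j * (real N / 2))} x)) (r / p)
      \<partial>count_space (int_points N)) \<partial>count_space UNIV)
    \<le> ennreal (geo_const (r - 2) * \<theta> powr (r - 2)) * (\<integral>\<^sup>+x. ennreal (u x powr 2) \<partial>leb N)"
proof -
  define v where "v j x = u x * indicator {x. u x < \<theta> * 2 powr (of_int j * (real N / 2))} x" for j :: int and x
  have [measurable]: "v j \<in> borel_measurable (leb N)" for j
    unfolding v_def by measurable
  define w where "w j = ennreal (2 powr - (of_int j * (real N / 2) * (r - 2)))" for j :: int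
  have "(\<integral>\<^sup>+j. (\<integral>\<^sup>+k. ennpow (scaled_mass N p j k (v j)) (r / p) \<partial>count_space (int_points N)) \<partial>count_space UNIV)
    \<le> (\<integral>\<^sup>+j. w j * (\<integral>\<^sup>+x. ennreal (v j x powr r) \<partial>leb N) \<partial>count_space UNIV)"
    unfolding w_def using p by (intro nn_integral_mono sum_scaled_mass_powr_le) auto
  also have "\<dots> = (\<integral>\<^sup>+x. (\<integral>\<^sup>+j. w j * ennreal (v j x powr r) \<partial>count_space UNIV) \<partial>leb N)"
    by (subst nn_integral_count_space_nn_integral) (auto simp: nn_integral_cmult)
  also have "\<dots> \<le> (\<integral>\<^sup>+x. ennreal (geo_const (r - 2) * \<theta> powr (r - 2)) * ennreal (u x powr 2) \<partial>leb N)"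
  proof (rule nn_integral_mono)
    fix x
    show "(\<integral>\<^sup>+j. w j * ennreal (v j x powr r) \<partial>count_space UNIV)
      \<le> ennreal (geo_const (r - 2) * \<theta> powr (r - 2)) * ennreal (u x powr 2)"
    proof (cases "u x = 0")
      case False
      have "(\<integral>\<^sup>+j. w j * ennreal (v j x powr r) \<partial>count_space UNIV)
        \<le> (\<integral>\<^sup>+j. ennreal (u x powr r) * (w j * indicator {j. u x / \<theta> \<le> 2 powr (of_int j * (real N / 2))} j) \<partial>count_space UNIV)"
        using \<open>0 < \<theta>\<close> by (intro nn_integral_mono) (auto simp: v_def indicator_def field_simps)
      also have "\<dots> = ennreal (u x powr r) * (\<integral>\<^sup>+j. w j * indicator {j. u x / \<theta> \<le> 2 powr (of_int j * (real N / 2))} j \<partial>count_space UNIV)"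
        by (simp add: nn_integral_cmult)
      also have "\<dots> \<le> ennreal (u x powr r) * ennreal (geo_const (r - 2) * (u x / \<theta>) powr - (r - 2))"
        unfolding w_def using N p nn[of x] \<open>0 < \<theta>\<close> False by (intro mult_left_mono sum_dyadic_above) auto
      also have "\<dots> = ennreal (u x powr r * (geo_const (r - 2) * (u x / \<theta>) powr - (r - 2)))"
        by (simp add: ennreal_mult')
      also have "u x powr r * (geo_const (r - 2) * (u x / \<theta>) powr - (r - 2)) = geo_const (r - 2) * \<theta> powr (r - 2) * u x powr 2"
        using powr_mult_powr_divide[of "u x" \<theta> r 2] nn[of x] \<open>0 < \<theta>\<close> False by auto
      also have "ennreal \<dots> = ennreal (geo_const (r - 2) * \<theta> powr (r - 2)) * ennreal (u x powr 2)"
        by (rule ennreal_mult'') simp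
      finally show ?thesis .
    qed (simp add: v_def)
  qed
  also have "\<dots> = ennreal (geo_const (r - 2) * \<theta> powr (r - 2)) * (\<integral>\<^sup>+x. ennreal (u x powr 2) \<partial>leb N)"
    by (simp add: nn_integral_cmult)
  finally show ?thesis
    unfolding v_def .
qed

definition embedding_const :: "real \<Rightarrow> real \<Rightarrow> real" where
  "embedding_const p r = 2 powr (r / p) * (geo_const (2 - p) powr (r / p) + geo_const (r - 2))"

text \<open>The threshold is put at \<open>\<theta>\<close>, the \<open>L\<^sup>2\<close> norm, times the \<open>L\<^sup>2\<close>-normalised height of a cube of the
scale; both parts then scale like \<open>\<theta>\<^sup>r\<close>.\<close>

lemma sum_scaled_mass_le:
  assumes N: "1 \<le> N" and p: "0 < p" "p < 2" "2 < r" and "0 \<le> \<theta>"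
    and [measurable]: "u \<in> borel_measurable (leb N)" and nn: "\<And>x. 0 \<le> u x"
    and u: "(\<integral>\<^sup>+x. ennreal (u x powr 2) \<partial>leb N) = ennreal (\<theta> powr 2)"
  shows "(\<integral>\<^sup>+j. (\<integral>\<^sup>+k. ennpow (scaled_mass N p j k u) (r / p) \<partial>count_space (int_points N)) \<partial>count_space UNIV)
    \<le> ennreal (embedding_const p r * \<theta> powr r)"
proof (cases "\<theta> = 0")
  case True
  then have "scaled_mass N p j k u = 0" for j k
    using scaled_mass_le[of p u N j k] p u by simp
  then show ?thesis by simp
next
  case False
  with \<open>0 \<le> \<theta>\<close> have "0 < \<theta>" by simp
  have s: "0 < r / p" "p < r" using p by auto
  define v where "v j x = u x * indicator {x. \<theta> * 2 powr (of_int j * (real N / 2)) \<le> u x} x" for j :: int and x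
  define w where "w j x = u x * indicator {x. u x < \<theta> * 2 powr (of_int j * (real N / 2))} x" for j :: int and x
  have [measurable]: "v j \<in> borel_measurable (leb N)" "w j \<in> borel_measurable (leb N)" for j
    unfolding v_def w_def by measurable
  have split: "scaled_mass N p j k u = scaled_mass N p j k (v j) + scaled_mass N p j k (w j)" for j k
  proof -
    have "ennreal (u x powr p) * indicator (cube N j k) x = ennreal (v j x powr p) * indicator (cube N j k) x
      + ennreal (w j x powr p) * indicator (cube N j k) x" for x
      by (auto simp: v_def w_def indicator_def)
    then show ?thesis
      unfolding scaled_mass_def by (simp add: nn_integral_add distrib_left)
  qed
  have "(\<integral>\<^sup>+j. (\<integral>\<^sup>+k. ennpow (scaled_mass N p j k u) (r / p) \<partial>count_space (int_points N)) \<partial>count_space UNIV)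
    \<le> (\<integral>\<^sup>+j. (\<integral>\<^sup>+k. ennreal (2 powr (r / p)) * (ennpow (scaled_mass N p j k (v j)) (r / p) + ennpow (scaled_mass N p j k (w j)) (r / p))
        \<partial>count_space (int_points N)) \<partial>count_space UNIV)"
    unfolding split using s by (intro nn_integral_mono ennpow_add_le) simp
  also have "\<dots> = ennreal (2 powr (r / p)) *
      ((\<integral>\<^sup>+j. (\<integral>\<^sup>+k. ennpow (scaled_mass N p j k (v j)) (r / p) \<partial>count_space (int_points N)) \<partial>count_space UNIV)
       + (\<integral>\<^sup>+j. (\<integral>\<^sup>+k. ennpow (scaled_mass N p j k (w j)) (r / p) \<partial>count_space (int_points N)) \<partial>count_space UNIV))"
    by (simp add: nn_integral_cmult nn_integral_add)
  also have "\<dots> \<le> ennreal (2 powr (r / p)) *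
      (ennpow (ennreal (geo_const (2 - p) * \<theta> powr (p - 2)) * ennreal (\<theta> powr 2)) (r / p)
       + ennreal (geo_const (r - 2) * \<theta> powr (r - 2)) * ennreal (\<theta> powr 2))"
    using sum_large_values_le[of N p r \<theta> u] sum_small_values_le[of N p r \<theta> u] N p s nn \<open>0 < \<theta>\<close>
    unfolding v_def w_def u by (intro mult_left_mono add_mono) auto
  also have "\<dots> = ennreal (2 powr (r / p) * ((geo_const (2 - p) * \<theta> powr (p - 2) * \<theta> powr 2) powr (r / p)
      + geo_const (r - 2) * \<theta> powr (r - 2) * \<theta> powr 2))"
    using geo_const_pos[of "2 - p"] geo_const_pos[of "r - 2"] p
    by (simp add: ennpow_ennreal less_imp_le mult_nonneg_nonneg flip: ennreal_mult ennreal_plus)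
  also have "geo_const (2 - p) * \<theta> powr (p - 2) * \<theta> powr 2 = geo_const (2 - p) * \<theta> powr p"
    by (simp add: mult.assoc flip: powr_add)
  also have "(geo_const (2 - p) * \<theta> powr p) powr (r / p) = geo_const (2 - p) powr (r / p) * \<theta> powr r"
    using geo_const_pos[of "2 - p"] p by (simp add: powr_mult powr_powr)
  also have "geo_const (r - 2) * \<theta> powr (r - 2) * \<theta> powr 2 = geo_const (r - 2) * \<theta> powr r"
    by (simp add: mult.assoc flip: powr_add)
  finally show ?thesis
    by (simp add: embedding_const_def algebra_simps)
qed

section \<open>The interpolation inequality and the embedding\<close>

lemma cube_sup_eq:
  "cube_sup N p f = (SUP (j, k)\<in>UNIV \<times> int_points N. scaled_mass N p j k (\<lambda>x. norm (f x)))"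
  by (simp add: cube_sup_def scaled_mass_def)

lemma scaled_mass_le_cube_sup:
  "k \<in> int_points N \<Longrightarrow> scaled_mass N p j k (\<lambda>x. norm (f x)) \<le> cube_sup N p f"
  unfolding cube_sup_eq by (rule SUP_upper2[where i = "(j, k)"]) auto

lemma Lp_norm_cube_restrict:
  "Lp_norm N p (cube_restrict N j k f) = ennpow (\<integral>\<^sup>+x\<in>cube N j k. ennreal (norm (f x) powr p) \<partial>leb N) (1 / p)"
  unfolding Lp_norm_def cube_restrict_def
  by (intro arg_cong2[where f = ennpow] nn_integral_cong) (auto simp: indicator_def)

lemma X_norm_le:
  assumes "0 < p" "0 < q"
  shows "X_norm N p q f \<le> ennpow (\<integral>\<^sup>+j. (\<integral>\<^sup>+k. ennpow (scaled_mass N p j k (\<lambda>x. norm (f x))) (q / p)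
    \<partial>count_space (int_points N)) \<partial>count_space UNIV) (1 / q)"
proof -
  define w where "w j = ennreal (2 powr (real_of_int j * (real N / 2) * ((2 - p) / p) * q))" for j
  have summand: "w j * ennpow (Lp_norm N p (cube_restrict N j k f)) q
    = ennpow (scaled_mass N p j k (\<lambda>x. norm (f x))) (q / p)" for j k
    using assms
    by (simp add: w_def scaled_mass_def ennpow_mult ennpow_ennreal Lp_norm_cube_restrict ennpow_ennpow powr_powr)
  have "(\<Sum>\<^sub>\<infinity>j\<in>UNIV. w j * (\<Sum>\<^sub>\<infinity>k\<in>int_points N. ennpow (Lp_norm N p (cube_restrict N j k f)) q))
    \<le> (\<integral>\<^sup>+j. w j * (\<Sum>\<^sub>\<infinity>k\<in>int_points N. ennpow (Lp_norm N p (cube_restrict N j k f)) q) \<partial>count_space UNIV)"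
    by (rule infsum_le_nn_integral)
  also have "\<dots> \<le> (\<integral>\<^sup>+j. w j * (\<integral>\<^sup>+k. ennpow (Lp_norm N p (cube_restrict N j k f)) q \<partial>count_space (int_points N)) \<partial>count_space UNIV)"
    by (intro nn_integral_mono mult_left_mono infsum_le_nn_integral) simp
  also have "\<dots> = (\<integral>\<^sup>+j. (\<integral>\<^sup>+k. ennpow (scaled_mass N p j k (\<lambda>x. norm (f x))) (q / p)
    \<partial>count_space (int_points N)) \<partial>count_space UNIV)"
    unfolding summand[symmetric] by (simp add: nn_integral_cmult)
  finally show ?thesis
    unfolding X_norm_def w_def using assms by (intro ennpow_mono) auto
qed

lemma Lp_spaceE:
  assumes "f \<in> Lp_space N 2"
  obtains \<theta> where "0 \<le> \<theta>" "Lp_norm N 2 f = ennreal \<theta>"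
    "(\<integral>\<^sup>+x. ennreal (norm (f x) powr 2) \<partial>leb N) = ennreal (\<theta> powr 2)"
proof -
  have "Lp_norm N 2 f < \<infinity>" using assms by (simp add: Lp_space_def)
  then obtain \<theta> where \<theta>: "0 \<le> \<theta>" "Lp_norm N 2 f = ennreal \<theta>"
    by (cases "Lp_norm N 2 f") auto
  have "(\<integral>\<^sup>+x. ennreal (norm (f x) powr 2) \<partial>leb N) = ennpow (Lp_norm N 2 f) 2"
    by (simp only: Lp_norm_def ennpow_ennpow) simp
  then have "(\<integral>\<^sup>+x. ennreal (norm (f x) powr 2) \<partial>leb N) = ennreal (\<theta> powr 2)"
    using \<theta> by (simp add: ennpow_ennreal)
  with \<theta> show thesis by (rule that)
qed

lemma cube_sup_le:
  assumes "0 < p" "p < 2" "f \<in> borel_measurable (leb N)"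
  shows "cube_sup N p f \<le> ennpow (Lp_norm N 2 f) p"
proof -
  have "scaled_mass N p j k (\<lambda>x. norm (f x)) \<le> ennpow (Lp_norm N 2 f) p" for j k
    using scaled_mass_le[of p "\<lambda>x. norm (f x)" N j k] assms by (simp add: Lp_norm_def ennpow_ennpow)
  then show ?thesis
    unfolding cube_sup_eq by (intro SUP_least) auto
qed

text \<open>Since \<open>r < q\<close>, a mass to the power \<open>q / p\<close> is at most the supremum of all masses to the power
\<open>(q - r) / p\<close> times the mass to the power \<open>r / p\<close>; the latter powers are summable.\<close>

lemma X_norm_le_interpolation:
  assumes N: "1 \<le> N" and p: "0 < p" "p < 2" and r: "2 < r" "r < q" and f: "f \<in> Lp_space N 2"
  shows "X_norm N p q f \<le> ennreal (embedding_const p r powr (1 / q)) *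
    ennpow (cube_sup N p f) ((q - r) / (p * q)) * ennpow (Lp_norm N 2 f) (r / q)"
proof -
  have [measurable]: "f \<in> borel_measurable (leb N)"
    using f by (simp add: Lp_space_def)
  obtain \<theta> where \<theta>: "0 \<le> \<theta>" "Lp_norm N 2 f = ennreal \<theta>"
    "(\<integral>\<^sup>+x. ennreal (norm (f x) powr 2) \<partial>leb N) = ennreal (\<theta> powr 2)"
    using f by (rule Lp_spaceE)
  let ?B = "\<lambda>j k. scaled_mass N p j k (\<lambda>x. norm (f x))"
  let ?S = "cube_sup N p f"
  let ?K = "embedding_const p r"
  have K: "0 \<le> ?K"
    using geo_const_pos[of "r - 2"] r by (simp add: embedding_const_def)
  have summand: "ennpow (?B j k) (q / p) \<le> ennpow ?S ((q - r) / p) * ennpow (?B j k) (r / p)" if "k \<in> int_points N" for j k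
  proof -
    have "ennpow (?B j k) (q / p) = ennpow (?B j k) ((q - r) / p) * ennpow (?B j k) (r / p)"
      by (simp add: diff_divide_distrib flip: ennpow_add)
    also have "\<dots> \<le> ennpow ?S ((q - r) / p) * ennpow (?B j k) (r / p)"
      using p r that by (intro mult_right_mono ennpow_mono scaled_mass_le_cube_sup) auto
    finally show ?thesis .
  qed
  have "X_norm N p q f \<le> ennpow (\<integral>\<^sup>+j. (\<integral>\<^sup>+k. ennpow (?B j k) (q / p) \<partial>count_space (int_points N)) \<partial>count_space UNIV) (1 / q)"
    using p r by (intro X_norm_le) auto
  also have "\<dots> \<le> ennpow (\<integral>\<^sup>+j. (\<integral>\<^sup>+k. ennpow ?S ((q - r) / p) * ennpow (?B j k) (r / p) \<partial>count_space (int_points N)) \<partial>count_space UNIV) (1 / q)"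
    using r by (intro ennpow_mono nn_integral_mono summand) auto
  also have "\<dots> = ennpow (ennpow ?S ((q - r) / p) * (\<integral>\<^sup>+j. (\<integral>\<^sup>+k. ennpow (?B j k) (r / p) \<partial>count_space (int_points N)) \<partial>count_space UNIV)) (1 / q)"
    by (simp add: nn_integral_cmult)
  also have "\<dots> \<le> ennpow (ennpow ?S ((q - r) / p) * ennreal (?K * \<theta> powr r)) (1 / q)"
    using r N p \<theta> by (intro ennpow_mono mult_left_mono sum_scaled_mass_le) auto
  also have "\<dots> = ennreal (?K powr (1 / q)) * ennpow ?S ((q - r) / (p * q)) * ennpow (ennreal \<theta>) (r / q)"
    using K \<theta>(1) r
    by (simp add: ennpow_mult ennpow_ennpow ennpow_ennreal powr_mult powr_powr ennreal_mult mult_ac)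
  finally show ?thesis
    by (simp add: \<theta>)
qed

text \<open>The coordinates are continuous, so a compact set lies in a box.\<close>

lemma emeasure_compact_subset_finite:
  assumes "compact K" "K \<subseteq> space (leb N)"
  obtains A where "A \<in> sets (leb N)" "K \<subseteq> A" "emeasure (leb N) A < top"
proof -
  have "\<exists>b. \<forall>x\<in>K. \<bar>x i\<bar> \<le> b" for i
  proof -
    have "continuous_on K (\<lambda>x. x i)"
      by (rule continuous_on_subset[OF continuous_on_product_coordinates subset_UNIV])
    then have "compact ((\<lambda>x. x i) ` K)"
      using assms(1) by (rule compact_continuous_image)
    then have "bounded ((\<lambda>x. x i) ` K)"
      by (rule compact_imp_bounded)
    then show ?thesis
      by (simp add: bounded_iff)
  qed
  then obtain b where b: "\<And>x i. x \<in> K \<Longrightarrow> \<bar>x i\<bar> \<le> b i"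
    by metis
  show thesis
  proof
    show "Pi\<^sub>E {1..N} (\<lambda>i. {- b i..b i}) \<in> sets (leb N)"
      by (rule PiE_sets_leb) simp
    show "K \<subseteq> Pi\<^sub>E {1..N} (\<lambda>i. {- b i..b i})"
    proof
      fix x assume "x \<in> K"
      then have "x \<in> {1..N} \<rightarrow>\<^sub>E UNIV"
        using assms(2) by (auto simp: leb_def space_PiM)
      moreover have "x i \<in> {- b i..b i}" for i
        using b[OF \<open>x \<in> K\<close>, of i] by auto
      ultimately show "x \<in> Pi\<^sub>E {1..N} (\<lambda>i. {- b i..b i})"
        by (auto simp: PiE_iff)
    qed
    have "emeasure (leb N) (Pi\<^sub>E {1..N} (\<lambda>i. {- b i..b i})) \<noteq> top"
      by (subst emeasure_leb_PiE) (auto simp: ennreal_prod_eq_top emeasure_lborel_Icc_eq)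
    then show "emeasure (leb N) (Pi\<^sub>E {1..N} (\<lambda>i. {- b i..b i})) < top"
      by (simp add: less_top)
  qed
qed

lemma Lp_locI:
  assumes [measurable]: "f \<in> borel_measurable (leb N)" "h \<in> borel_measurable (leb N)"
    and le: "\<And>x. ennreal (norm (f x) powr p) \<le> 1 + h x" and h: "(\<integral>\<^sup>+x. h x \<partial>leb N) < top"
  shows "f \<in> Lp_loc N p"
  unfolding Lp_loc_def
proof (clarsimp simp: assms(1))
  fix K assume "compact K" "K \<subseteq> space (leb N)"
  then obtain A where [measurable]: "A \<in> sets (leb N)" and A: "K \<subseteq> A" "emeasure (leb N) A < top"
    by (rule emeasure_compact_subset_finite)
  have "(\<integral>\<^sup>+x\<in>K. ennreal (norm (f x) powr p) \<partial>leb N) \<le> (\<integral>\<^sup>+x. indicator A x + h x \<partial>leb N)"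
    using A(1) le by (intro nn_integral_mono) (auto simp: indicator_def)
  also have "\<dots> = emeasure (leb N) A + (\<integral>\<^sup>+x. h x \<partial>leb N)"
    by (subst nn_integral_add) auto
  also have "\<dots> < top"
    using A h by simp
  finally show "(\<integral>\<^sup>+x\<in>K. ennreal (norm (f x) powr p) \<partial>leb N) < top" .
qed

lemma Lp_space_2_subset_Lp_loc:
  assumes "0 < p" "p < 2"
  shows "Lp_space N 2 \<subseteq> Lp_loc N p"
proof
  fix f assume f: "f \<in> Lp_space N 2"
  then have [measurable]: "f \<in> borel_measurable (leb N)"
    by (simp add: Lp_space_def)
  have fin: "(\<integral>\<^sup>+x. ennreal (norm (f x) powr 2) \<partial>leb N) < top"
    using f by (rule Lp_spaceE) simp
  show "f \<in> Lp_loc N p"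
  proof (rule Lp_locI[where h = "\<lambda>x. ennreal (norm (f x) powr 2)"])
    fix x
    have "norm (f x) powr p \<le> 1 + norm (f x) powr 2"
    proof (cases "norm (f x) \<le> 1")
      case True
      then have "norm (f x) powr p \<le> 1"
        using assms by (intro powr_le1) auto
      then show ?thesis using powr_ge_zero[of "norm (f x)" 2] by linarith
    next
      case False
      then have "norm (f x) powr p \<le> norm (f x) powr 2"
        using assms by (intro powr_mono) auto
      then show ?thesis by linarith
    qed
    then have "ennreal (norm (f x) powr p) \<le> ennreal (1 + norm (f x) powr 2)"
      by (rule ennreal_leI)
    then show "ennreal (norm (f x) powr p) \<le> 1 + ennreal (norm (f x) powr 2)"
      by simp
  qed (use fin in simp_all)
qed

text \<open>Continuity needs the bound for a difference of two functions; that the difference lies in \<open>L\<^sup>2\<close> is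
immediate, as its norm is assumed to be small.\<close>

lemma continuously_embedded_Lp_X:
  assumes N: "1 \<le> N" and p: "0 < p" "p < 2" and "0 < C"
    and bound: "\<And>f. f \<in> Lp_space N 2 \<Longrightarrow> X_norm N p q f \<le> ennreal C * Lp_norm N 2 f"
  shows "continuously_embedded (Lp_space N 2) (Lp_norm N 2) (X_space N p q) (X_norm N p q)"
  unfolding continuously_embedded_def
proof (intro conjI ballI allI impI)
  show "Lp_space N 2 \<subseteq> X_space N p q"
  proof
    fix f assume f: "f \<in> Lp_space N 2"
    have "X_norm N p q f \<le> ennreal C * Lp_norm N 2 f"
      using f by (rule bound)
    also have "\<dots> < \<infinity>"
      using f by (simp add: Lp_space_def ennreal_mult_less_top)
    finally show "f \<in> X_space N p q"
      using f Lp_space_2_subset_Lp_loc[OF p] by (auto simp: X_space_def)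
  qed
next
  fix f :: "(nat \<Rightarrow> real) \<Rightarrow> complex" and \<epsilon> :: real
  assume f: "f \<in> Lp_space N 2" and "0 < \<epsilon>"
  show "\<exists>\<delta>>0. \<forall>g\<in>Lp_space N 2. Lp_norm N 2 (\<lambda>x. g x - f x) < ennreal \<delta> \<longrightarrow>
    X_norm N p q (\<lambda>x. g x - f x) < ennreal \<epsilon>"
  proof (intro exI[of _ "\<epsilon> / C"] conjI ballI impI)
    fix g assume g: "g \<in> Lp_space N 2" and less: "Lp_norm N 2 (\<lambda>x. g x - f x) < ennreal (\<epsilon> / C)"
    have "(\<lambda>x. g x - f x) \<in> borel_measurable (leb N)"
      using f g by (auto simp: Lp_space_def)
    then have "(\<lambda>x. g x - f x) \<in> Lp_space N 2"
      using less by (auto simp: Lp_space_def elim: less_trans)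
    then have "X_norm N p q (\<lambda>x. g x - f x) \<le> ennreal C * Lp_norm N 2 (\<lambda>x. g x - f x)"
      by (rule bound)
    also have "\<dots> < ennreal C * ennreal (\<epsilon> / C)"
      using less \<open>0 < C\<close> by (intro ennreal_mult_strict_left_mono) auto
    also have "\<dots> = ennreal \<epsilon>"
      using \<open>0 < C\<close> \<open>0 < \<epsilon>\<close> by (simp flip: ennreal_mult)
    finally show "X_norm N p q (\<lambda>x. g x - f x) < ennreal \<epsilon>" .
  qed (use \<open>0 < C\<close> \<open>0 < \<epsilon>\<close> in simp)
qed

lemma interpolation_le_Lp_norm:
  assumes "0 < p" "p < 2" "0 < \<mu>" "f \<in> borel_measurable (leb N)"
  shows "ennpow (cube_sup N p f) \<mu> * ennpow (Lp_norm N 2 f) (1 - \<mu> * p) \<le> Lp_norm N 2 f"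
proof -
  have "ennpow (cube_sup N p f) \<mu> \<le> ennpow (ennpow (Lp_norm N 2 f) p) \<mu>"
    using assms by (intro ennpow_mono cube_sup_le) auto
  then have "ennpow (cube_sup N p f) \<mu> * ennpow (Lp_norm N 2 f) (1 - \<mu> * p)
    \<le> ennpow (Lp_norm N 2 f) (p * \<mu>) * ennpow (Lp_norm N 2 f) (1 - \<mu> * p)"
    unfolding ennpow_ennpow by (rule mult_right_mono) simp
  also have "\<dots> = Lp_norm N 2 f"
    by (simp add: mult.commute flip: ennpow_add)
  finally show ?thesis .
qed

section \<open>A function in the larger space that is not square integrable\<close>

text \<open>The corners \<open>2\<^sup>n\<close> on the first axis are so sparse that away from the origin a dyadic cube of any
size meets at most one of these unit cubes.\<close>

definition spike_cube :: "nat \<Rightarrow> nat \<Rightarrow> (nat \<Rightarrow> real) set" where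
  "spike_cube N n = cube N 0 (\<lambda>m. if m = 1 then 2 ^ n else 0)"

text \<open>The squares of the heights just fail to be summable, while all higher powers are summable.\<close>

definition spikes :: "nat \<Rightarrow> (nat \<Rightarrow> real) \<Rightarrow> real" where
  "spikes N x = (\<Sum>n. real (Suc n) powr (- 1 / 2) * indicator (spike_cube N n) x)"

lemma sets_spike_cube [measurable]: "spike_cube N n \<in> sets (leb N)"
  by (simp add: spike_cube_def)

lemma emeasure_spike_cube: "emeasure (leb N) (spike_cube N n) = 1"
  by (simp add: spike_cube_def emeasure_cube)

lemma borel_measurable_spikes [measurable]: "spikes N \<in> borel_measurable (leb N)"
  unfolding spikes_def by measurable

lemma spike_cube_floor:
  assumes "1 \<le> N" "x \<in> spike_cube N n"
  shows "\<lfloor>x 1\<rfloor> = 2 ^ n"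
  using cube_eq_floor[OF assms(2)[unfolded spike_cube_def], of 1] assms(1) by simp

lemma spike_cube_unique:
  assumes "1 \<le> N" "x \<in> spike_cube N n" "x \<in> spike_cube N m"
  shows "n = m"
proof -
  have "(2::int) ^ n = 2 ^ m"
    by (rule trans[OF spike_cube_floor[OF assms(1,2), symmetric] spike_cube_floor[OF assms(1,3)]])
  then show ?thesis by simp
qed

lemma spike_cube_suminf:
  fixes g :: "nat \<Rightarrow> 'a :: {semiring_1, t2_space}"
  assumes "1 \<le> N" "x \<in> spike_cube N n"
  shows "(\<Sum>m. g m * indicator (spike_cube N m) x) = g n"
proof -
  have "(\<Sum>m. g m * indicator (spike_cube N m) x) = (\<Sum>m\<in>{n}. g m * indicator (spike_cube N m) x)"
    using spike_cube_unique[OF assms(1) _ assms(2)] by (intro suminf_finite) (auto simp: indicator_def)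
  then show ?thesis
    using assms by simp
qed

lemma spikes_eq: "1 \<le> N \<Longrightarrow> x \<in> spike_cube N n \<Longrightarrow> spikes N x = real (Suc n) powr (- 1 / 2)"
  unfolding spikes_def by (rule spike_cube_suminf)

lemma spikes_eq_0: "(\<And>n. x \<notin> spike_cube N n) \<Longrightarrow> spikes N x = 0"
  by (simp add: spikes_def)

lemma spikes_bounds:
  assumes "1 \<le> N"
  shows "0 \<le> spikes N x" "spikes N x \<le> 1"
proof -
  have *: "real (Suc n) powr (- 1 / 2) \<le> 1" for n
    using powr_mono2'[of "- 1 / 2" 1 "real (Suc n)"] by simp
  have "0 \<le> spikes N x \<and> spikes N x \<le> 1"
  proof (cases "\<exists>n. x \<in> spike_cube N n")
    case True
    then obtain n where "x \<in> spike_cube N n" by blast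
    then show ?thesis
      unfolding spikes_eq[OF assms \<open>x \<in> spike_cube N n\<close>] using *[of n] by simp
  qed (simp add: spikes_eq_0)
  then show "0 \<le> spikes N x" "spikes N x \<le> 1"
    by auto
qed

lemma nn_integral_spikes_powr:
  assumes "1 \<le> N"
  shows "(\<integral>\<^sup>+x. ennreal (spikes N x powr s) \<partial>leb N) = (\<Sum>n. ennreal (real (Suc n) powr (- s / 2)))"
proof -
  have "ennreal (spikes N x powr s) = (\<Sum>n. ennreal (real (Suc n) powr (- s / 2)) * indicator (spike_cube N n) x)" for x
  proof (cases "\<exists>n. x \<in> spike_cube N n")
    case True
    then obtain n where "x \<in> spike_cube N n" by blast
    then show ?thesis
      using assms by (simp add: spikes_eq spike_cube_suminf powr_powr)
  qed (simp add: spikes_eq_0)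
  then show ?thesis
    by (simp add: nn_integral_suminf nn_integral_cmult emeasure_spike_cube)
qed

lemma nn_integral_spikes_powr_less_top:
  assumes "1 \<le> N" "2 < s"
  shows "(\<integral>\<^sup>+x. ennreal (spikes N x powr s) \<partial>leb N) < top"
proof -
  have "summable (\<lambda>n. real (Suc n) powr (- s / 2))"
    using assms summable_real_powr_iff[of "- s / 2"] by (subst summable_Suc_iff) simp
  then show ?thesis
    using assms by (simp add: nn_integral_spikes_powr less_top suminf_ennreal2)
qed

lemma spikes_notin_L2:
  assumes "1 \<le> N"
  shows "(\<integral>\<^sup>+x. ennreal (spikes N x powr 2) \<partial>leb N) = top"
proof (rule ccontr)
  assume "(\<integral>\<^sup>+x. ennreal (spikes N x powr 2) \<partial>leb N) \<noteq> top"
  then have "summable (\<lambda>n. real (Suc n) powr (- 2 / 2))"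
    using assms by (intro summable_suminf_not_top) (simp_all add: nn_integral_spikes_powr)
  then show False
    using summable_real_powr_iff[of "- 2 / 2"] by (subst (asm) summable_Suc_iff) simp
qed

text \<open>Dividing the integer part of the first coordinate by \<open>2\<^sup>l\<close>, where \<open>2\<^sup>l\<close> is the side of the cube, gives
\<open>2\<^bsup>n-l\<^esup>\<close>, or \<open>0\<close> for \<open>n < l\<close>. A cube with \<open>1 \<le> k 1\<close> excludes the latter and determines \<open>n\<close>.\<close>

lemma coarse_cube_one_spike:
  assumes N: "1 \<le> N" and "j \<le> 0" and "1 \<le> k 1"
    and x: "x \<in> cube N j k" "x \<in> spike_cube N n" and y: "y \<in> cube N j k" "y \<in> spike_cube N m"
  shows "n = m"
proof -
  define l where "l = nat (- j)"
  have exponent: "k 1 = 2 ^ (i - l) \<and> l \<le> i" if "z \<in> cube N j k" "z \<in> spike_cube N i" for z i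
  proof -
    have "k 1 = \<lfloor>z 1 * 2 powi j\<rfloor>"
      using cube_eq_floor[OF that(1), of 1] N by simp
    also have "z 1 * 2 powi j = z 1 / real_of_int (2 ^ l)"
      using \<open>j \<le> 0\<close> by (simp add: l_def power_int_def field_simps)
    also have "\<lfloor>z 1 / real_of_int (2 ^ l)\<rfloor> = \<lfloor>z 1\<rfloor> div 2 ^ l"
      by (rule floor_divide_real_eq_div) simp
    also have "\<dots> = 2 ^ i div 2 ^ l"
      using spike_cube_floor[OF N that(2)] by simp
    finally have k: "k 1 = 2 ^ i div 2 ^ l" .
    have "l \<le> i"
    proof (rule ccontr)
      assume "\<not> l \<le> i"
      then have "(2::int) ^ i < 2 ^ l" by simp
      then have "(2::int) ^ i div 2 ^ l = 0" by (intro div_pos_pos_trivial) auto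
      with k \<open>1 \<le> k 1\<close> show False by simp
    qed
    then show ?thesis
      using k by (simp add: power_diff)
  qed
  have "(2::int) ^ (n - l) = 2 ^ (m - l)" "l \<le> n" "l \<le> m"
    using exponent[OF x] exponent[OF y] by auto
  then show ?thesis by simp
qed

text \<open>On a cube with \<open>1 \<le> k 1\<close> the function lives on a set of measure at most \<open>1\<close>, rather than on the whole huge
cube. Hoelder's inequality on that set keeps the decaying weight of the scale, which Hoelder's
inequality on the cube would turn into a growing one.\<close>

lemma scaled_mass_spikes_le:
  assumes N: "1 \<le> N" and p: "0 < p" "p < q" and "j \<le> 0" "1 \<le> k 1"
  shows "ennpow (scaled_mass N p j k (spikes N)) (q / p)
    \<le> ennpow (ennreal (2 powr (of_int j * (real N / 2) * (2 - p)))) (q / p) *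
       (\<integral>\<^sup>+x\<in>cube N j k. ennreal (spikes N x powr q) \<partial>leb N)"
proof -
  obtain n where n: "\<And>x. x \<in> cube N j k \<Longrightarrow> spikes N x \<noteq> 0 \<Longrightarrow> x \<in> spike_cube N n"
    using coarse_cube_one_spike[of N j k] assms spikes_eq_0[of _ N] by metis
  let ?A = "cube N j k \<inter> spike_cube N n"
  have restrict: "(\<integral>\<^sup>+x\<in>cube N j k. ennreal (spikes N x powr s) \<partial>leb N) = (\<integral>\<^sup>+x\<in>?A. ennreal (spikes N x powr s) \<partial>leb N)" for s
    using n by (intro nn_integral_cong) (auto simp: indicator_def)
  have "emeasure (leb N) ?A \<le> ennreal 1"
    using emeasure_mono[of ?A "spike_cube N n" "leb N"] by (simp add: emeasure_spike_cube)
  then have "ennpow (\<integral>\<^sup>+x\<in>?A. ennreal (spikes N x powr p) \<partial>leb N) (q / p)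
    \<le> ennreal (1 powr (q / p - 1)) * (\<integral>\<^sup>+x\<in>?A. ennreal ((spikes N x powr p) powr (q / p)) \<partial>leb N)"
    using p by (intro ennpow_nn_integral_le) auto
  also have "\<dots> = (\<integral>\<^sup>+x\<in>?A. ennreal (spikes N x powr q) \<partial>leb N)"
    using p by (simp add: powr_powr)
  finally show ?thesis
    unfolding scaled_mass_def ennpow_mult restrict by (intro mult_left_mono) auto
qed

text \<open>Only the spikes number \<open>0, \<dots>, l - 1\<close> start below \<open>2\<^sup>l\<close>, and each contributes at most \<open>1\<close>.\<close>

lemma nn_integral_spikes_near_le:
  assumes N: "1 \<le> N" and "0 < p"
  shows "(\<integral>\<^sup>+x. ennreal (spikes N x powr p) * indicator {x. x 1 < 2 ^ l} x \<partial>leb N) \<le> ennreal (real l)"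
proof -
  have "ennreal (spikes N x powr p) * indicator {x. x 1 < 2 ^ l} x \<le> (\<Sum>n<l. indicator (spike_cube N n) x)" for x
  proof (cases "spikes N x = 0 \<or> 2 ^ l \<le> x 1")
    case False
    then obtain n where n: "x \<in> spike_cube N n"
      using spikes_eq_0 by blast
    have "2 ^ n \<le> x 1"
      using of_int_floor_le[of "x 1"] unfolding spike_cube_floor[OF N n] by simp
    also have "x 1 < 2 ^ l"
      using False by simp
    finally have "(2::real) ^ n < 2 ^ l" .
    then have "n < l" by simp
    have "ennreal (spikes N x powr p) \<le> 1"
      using spikes_bounds[OF N, of x] assms powr_le1[of p "spikes N x"] by simp
    then have "ennreal (spikes N x powr p) * indicator {x. x 1 < 2 ^ l} x \<le> indicator (spike_cube N n) x"
      using n by (auto simp: indicator_def)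
    also have "\<dots> \<le> (\<Sum>n<l. indicator (spike_cube N n) x)"
      using \<open>n < l\<close> by (intro member_le_sum) auto
    finally show ?thesis .
  qed auto
  then have "(\<integral>\<^sup>+x. ennreal (spikes N x powr p) * indicator {x. x 1 < 2 ^ l} x \<partial>leb N)
    \<le> (\<integral>\<^sup>+x. (\<Sum>n<l. indicator (spike_cube N n) x) \<partial>leb N)"
    by (rule nn_integral_mono)
  also have "\<dots> = of_nat l"
    by (subst nn_integral_sum) (auto simp: emeasure_spike_cube)
  finally show ?thesis
    by (simp add: ennreal_of_nat_eq_real_of_nat)
qed

text \<open>The cubes that reach into \<open>x 1 < 2\<^sup>l\<close>, with \<open>2\<^sup>l\<close> their side, are the ones with \<open>k 1 \<le> 0\<close> and lie in that
half-space entirely; together they catch at most \<open>l = -j\<close> spikes. The others catch at most one each.\<close>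

lemma sum_scaled_mass_spikes_coarse_le:
  assumes N: "1 \<le> N" and p: "0 < p" "p < q" and "j \<le> 0"
  shows "(\<integral>\<^sup>+k. ennpow (scaled_mass N p j k (spikes N)) (q / p) \<partial>count_space (int_points N))
    \<le> ennpow (ennreal (2 powr (of_int j * (real N / 2) * (2 - p)))) (q / p) *
       (ennpow (ennreal (- of_int j)) (q / p) + (\<integral>\<^sup>+x. ennreal (spikes N x powr q) \<partial>leb N))"
proof -
  define l where "l = nat (- j)"
  define W where "W = ennreal (2 powr (of_int j * (real N / 2) * (2 - p)))"
  define g where "g x = ennreal (spikes N x powr p) * indicator {x. x 1 < 2 ^ l} x" for x
  have "(\<lambda>x. x 1) \<in> borel_measurable (leb N)"
    unfolding leb_def using N by (intro measurable_completion) (auto intro!: measurable_component_singleton[THEN measurable_compose])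
  then have [measurable]: "g \<in> borel_measurable (leb N)"
    unfolding g_def by measurable
  have each: "ennpow (scaled_mass N p j k (spikes N)) (q / p)
    \<le> ennpow W (q / p) * ennpow (\<integral>\<^sup>+x\<in>cube N j k. g x \<partial>leb N) (q / p)
     + ennpow W (q / p) * (\<integral>\<^sup>+x\<in>cube N j k. ennreal (spikes N x powr q) \<partial>leb N)" for k
  proof (cases "1 \<le> k 1")
    case True
    then show ?thesis
      using scaled_mass_spikes_le[OF N p \<open>j \<le> 0\<close>] unfolding W_def by (meson add_increasing order.trans zero_le)
  next
    case False
    have near: "x 1 < 2 ^ l" if "x \<in> cube N j k" for x
    proof -
      have "x 1 < (real_of_int (k 1) + 1) * 2 powi (- j)"
        using that N by (auto simp: cube_def PiE_iff)
      also have "\<dots> \<le> 1 * 2 powi (- j)"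
        using False by (intro mult_right_mono) auto
      also have "\<dots> = 2 ^ l"
        using \<open>j \<le> 0\<close> by (simp add: l_def power_int_def)
      finally show ?thesis .
    qed
    have "(\<integral>\<^sup>+x\<in>cube N j k. ennreal (spikes N x powr p) \<partial>leb N) = (\<integral>\<^sup>+x\<in>cube N j k. g x \<partial>leb N)"
      unfolding g_def using near by (intro nn_integral_cong) (auto simp: indicator_def)
    then have "scaled_mass N p j k (spikes N) = W * (\<integral>\<^sup>+x\<in>cube N j k. g x \<partial>leb N)"
      by (simp add: scaled_mass_def W_def)
    then show ?thesis
      by (simp add: ennpow_mult)
  qed
  have s: "1 < q / p" using p by simp
  have "(\<integral>\<^sup>+k. ennpow (scaled_mass N p j k (spikes N)) (q / p) \<partial>count_space (int_points N))
    \<le> (\<integral>\<^sup>+k. ennpow W (q / p) * ennpow (\<integral>\<^sup>+x\<in>cube N j k. g x \<partial>leb N) (q / p)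
     + ennpow W (q / p) * (\<integral>\<^sup>+x\<in>cube N j k. ennreal (spikes N x powr q) \<partial>leb N) \<partial>count_space (int_points N))"
    by (intro nn_integral_mono each)
  also have "\<dots> = ennpow W (q / p) *
    ((\<integral>\<^sup>+k. ennpow (\<integral>\<^sup>+x\<in>cube N j k. g x \<partial>leb N) (q / p) \<partial>count_space (int_points N))
     + (\<integral>\<^sup>+k. (\<integral>\<^sup>+x\<in>cube N j k. ennreal (spikes N x powr q) \<partial>leb N) \<partial>count_space (int_points N)))"
    by (simp add: nn_integral_add nn_integral_cmult distrib_left)
  also have "\<dots> \<le> ennpow W (q / p) * (ennpow (ennreal (real l)) (q / p) + (\<integral>\<^sup>+x. ennreal (spikes N x powr q) \<partial>leb N))"
  proof (intro mult_left_mono add_mono sum_cubes_le)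
    have "(\<integral>\<^sup>+k. ennpow (\<integral>\<^sup>+x\<in>cube N j k. g x \<partial>leb N) (q / p) \<partial>count_space (int_points N))
      \<le> ennpow (\<integral>\<^sup>+k. (\<integral>\<^sup>+x\<in>cube N j k. g x \<partial>leb N) \<partial>count_space (int_points N)) (q / p)"
      by (rule sum_ennpow_le[OF s])
    also have "\<dots> \<le> ennpow (\<integral>\<^sup>+x. g x \<partial>leb N) (q / p)"
      using s by (intro ennpow_mono sum_cubes_le) auto
    also have "\<dots> \<le> ennpow (ennreal (real l)) (q / p)"
      using s nn_integral_spikes_near_le[OF N p(1), of l] unfolding g_def by (intro ennpow_mono) auto
    finally show "(\<integral>\<^sup>+k. ennpow (\<integral>\<^sup>+x\<in>cube N j k. g x \<partial>leb N) (q / p) \<partial>count_space (int_points N))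
      \<le> ennpow (ennreal (real l)) (q / p)" .
  qed auto
  finally show ?thesis
    using \<open>j \<le> 0\<close> by (simp add: W_def l_def)
qed

lemma powr_le_exponential:
  fixes t \<beta> :: real
  assumes "0 < t" "0 < \<beta>"
  obtains c where "0 \<le> c" "\<And>y. 0 \<le> y \<Longrightarrow> y powr t \<le> c * 2 powr (\<beta> * y)"
proof
  \<comment> \<open>The \<open>t\<close>-th power of \<open>exp (a y)\<close> is \<open>2\<^bsup>\<beta>y\<^esup>\<close>, and \<open>a y \<le> exp (a y)\<close>.\<close>
  define a where "a = \<beta> * ln 2 / t"
  have "0 < a" using assms by (simp add: a_def)
  show "0 \<le> (1 / a) powr t" by simp
  fix y :: real assume "0 \<le> y"
  have "a * y \<le> exp (a * y)"
    using exp_ge_add_one_self[of "a * y"] by linarith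
  then have "y \<le> (1 / a) * exp (a * y)"
    using \<open>0 < a\<close> by (simp add: field_simps)
  then have "y powr t \<le> ((1 / a) * exp (a * y)) powr t"
    using assms \<open>0 \<le> y\<close> by (intro powr_mono2) auto
  also have "\<dots> = (1 / a) powr t * exp (a * y) powr t"
    by (rule powr_mult)
  also have "exp (a * y) powr t = 2 powr (\<beta> * y)"
    using assms by (simp add: powr_def a_def)
  finally show "y powr t \<le> (1 / a) powr t * 2 powr (\<beta> * y)" .
qed

text \<open>For fine scales the generic estimate suffices, as the function belongs to \<open>L\<^sup>q\<close> with \<open>q > 2\<close>. For coarse
scales the weight decays exponentially in \<open>-j\<close>: one half of the exponent absorbs the polynomial
number of spikes near the origin, the other half is summed.\<close>

lemma spikes_sum_less_top:
  assumes N: "1 \<le> N" and p: "0 < p" "p < 2" "2 < q"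
  shows "(\<integral>\<^sup>+j. (\<integral>\<^sup>+k. ennpow (scaled_mass N p j k (spikes N)) (q / p) \<partial>count_space (int_points N)) \<partial>count_space UNIV) < top"
proof -
  let ?T = "\<lambda>j. \<integral>\<^sup>+k. ennpow (scaled_mass N p j k (spikes N)) (q / p) \<partial>count_space (int_points N)"
  define F where "F = (\<integral>\<^sup>+x. ennreal (spikes N x powr q) \<partial>leb N)"
  have F: "F < top"
    unfolding F_def using N p by (intro nn_integral_spikes_powr_less_top)
  have pq: "p < q" "0 < q / p" using p by auto
  \<comment> \<open>The weight of scale \<open>j\<close> is \<open>e\<^sup>2\<close> for the \<open>e\<close> below: hence the division by two.\<close>
  define \<alpha> where "\<alpha> = (2 - p) * (q / p) / 2"
  have "0 < \<alpha>" using p by (simp add: \<alpha>_def)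
  then obtain c where c: "0 \<le> c" "\<And>y. 0 \<le> y \<Longrightarrow> y powr (q / p) \<le> c * 2 powr (\<alpha> / 2 * y)"
    using powr_le_exponential[of "q / p" "\<alpha> / 2"] pq by auto
  define fine_term where "fine_term j = ennreal (2 powr - (of_int j * (real N / 2) * (q - 2))) *
    indicator {j. 1 \<le> 2 powr (of_int j * (real N / 2))} j" for j :: int
  define coarse_term where "coarse_term j = ennreal (2 powr (of_int j * (real N / 2) * \<alpha>)) *
    indicator {j. 2 powr (of_int j * (real N / 2)) \<le> 1} j" for j :: int
  have "?T j \<le> F * fine_term j + (ennreal c + F) * coarse_term j" for j
  proof (cases "0 \<le> j")
    case True
    then have "fine_term j = ennreal (2 powr - (of_int j * (real N / 2) * (q - 2)))"
      by (simp add: fine_term_def indicator_def ge_one_powr_ge_zero)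
    then have "?T j \<le> F * fine_term j"
      using sum_scaled_mass_powr_le[of p q "spikes N" N j] p pq
      by (simp add: F_def mult.commute)
    then show ?thesis
      by (simp add: add_increasing2)
  next
    case False
    define e where "e = 2 powr (of_int j * (real N / 2) * \<alpha>)"
    have scale: "of_int j * (real N / 2) \<le> 0"
      using False by (intro mult_nonpos_nonneg) auto
    have "of_int j * (real N / 2) * \<alpha> \<le> 0"
      using \<open>0 < \<alpha>\<close> by (intro mult_nonpos_nonneg[OF scale]) simp
    then have "e \<le> 1"
      using powr_mono[of "of_int j * (real N / 2) * \<alpha>" 0 2] by (simp add: e_def)
    have W: "ennpow (ennreal (2 powr (of_int j * (real N / 2) * (2 - p)))) (q / p) = ennreal (e * e)"
      by (simp add: ennpow_ennreal powr_powr e_def \<alpha>_def mult_ac flip: powr_add)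
    have "?T j \<le> ennreal (e * e) * (ennpow (ennreal (- of_int j)) (q / p) + F)"
      using sum_scaled_mass_spikes_coarse_le[OF N p(1) pq(1), of j] False unfolding W F_def by simp
    also have "\<dots> = ennreal (e * e * (- of_int j) powr (q / p)) + ennreal (e * e) * F"
      using False by (simp add: ennpow_ennreal distrib_left ennreal_mult' del: of_int_minus)
    also have "\<dots> \<le> ennreal (c * e) + ennreal e * F"
    proof (intro add_mono mult_right_mono ennreal_leI)
      show "e * e \<le> e"
        using \<open>e \<le> 1\<close> mult_left_mono[of e 1 e] by (simp add: e_def)
      have "(- real_of_int j) powr (q / p) \<le> c * 2 powr (\<alpha> / 2 * (- of_int j))"
        using False by (intro c) simp
      also have "\<dots> \<le> c * 2 powr (- (of_int j * (real N / 2) * \<alpha>))"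
        using False N \<open>0 < \<alpha>\<close> c(1) by (intro mult_left_mono) (auto simp: field_simps)
      finally have "e * e * (- of_int j) powr (q / p) \<le> e * e * (c * 2 powr (- (of_int j * (real N / 2) * \<alpha>)))"
        by (intro mult_left_mono) (auto simp: e_def)
      also have "\<dots> = c * e"
        by (simp add: e_def powr_minus)
      finally show "e * e * (- of_int j) powr (q / p) \<le> c * e" .
    qed auto
    also have "\<dots> = (ennreal c + F) * coarse_term j"
    proof -
      have "coarse_term j = ennreal e"
        using powr_mono[OF scale, of 2] by (simp add: coarse_term_def e_def)
      then show ?thesis
        using c(1) by (simp add: distrib_left ennreal_mult' mult.commute)
    qed
    finally show ?thesis
      by (simp add: add_increasing)
  qed
  then have "(\<integral>\<^sup>+j. ?T j \<partial>count_space UNIV) \<le> (\<integral>\<^sup>+j. F * fine_term j + (ennreal c + F) * coarse_term j \<partial>count_space UNIV)"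
    by (intro nn_integral_mono)
  also have "\<dots> = F * (\<integral>\<^sup>+j. fine_term j \<partial>count_space UNIV) + (ennreal c + F) * (\<integral>\<^sup>+j. coarse_term j \<partial>count_space UNIV)"
    by (simp add: nn_integral_add nn_integral_cmult)
  also have "\<dots> \<le> F * ennreal (geo_const (q - 2) * 1 powr - (q - 2)) + (ennreal c + F) * ennreal (geo_const \<alpha> * 1 powr \<alpha>)"
    unfolding fine_term_def coarse_term_def using N p \<open>0 < \<alpha>\<close>
    by (intro add_mono mult_left_mono sum_dyadic_above sum_dyadic_below) auto
  also have "\<dots> < top"
    using F by (simp add: ennreal_mult_less_top)
  finally show ?thesis .
qed

lemma spikes_in_X_space:
  assumes N: "1 \<le> N" and p: "0 < p" "p < 2" "2 < q"
  shows "(\<lambda>x. complex_of_real (spikes N x)) \<in> X_space N p q"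
proof -
  have norm: "norm (complex_of_real (spikes N x)) = spikes N x" for x
    using spikes_bounds[OF N] by simp
  have "X_norm N p q (\<lambda>x. complex_of_real (spikes N x)) \<le> ennpow (\<integral>\<^sup>+j. (\<integral>\<^sup>+k.
      ennpow (scaled_mass N p j k (spikes N)) (q / p) \<partial>count_space (int_points N)) \<partial>count_space UNIV) (1 / q)"
    using X_norm_le[of p q N "\<lambda>x. complex_of_real (spikes N x)"] p unfolding norm by simp
  also have "\<dots> < top"
    using spikes_sum_less_top[OF assms] by simp
  finally have "X_norm N p q (\<lambda>x. complex_of_real (spikes N x)) < top" .
  moreover have "(\<lambda>x. complex_of_real (spikes N x)) \<in> Lp_loc N p"
  proof (rule Lp_locI[where h = "\<lambda>_. 0"])
    show "ennreal (norm (complex_of_real (spikes N x)) powr p) \<le> 1 + 0" for x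
      using spikes_bounds[OF N, of x] powr_le1[of p "spikes N x"] p unfolding norm by simp
  qed simp_all
  ultimately show ?thesis
    by (simp add: X_space_def)
qed

lemma spikes_notin_Lp_space:
  assumes "1 \<le> N"
  shows "(\<lambda>x. complex_of_real (spikes N x)) \<notin> Lp_space N 2"
  using spikes_notin_L2[OF assms] spikes_bounds[OF assms] by (simp add: Lp_space_def Lp_norm_def)

theorem theorem1p3:
  fixes p q :: real
  assumes "2 < q" and "1 < p" and "p < 2"
  shows "(\<exists>\<mu> C :: real. 0 < \<mu> \<and> \<mu> < 1 / p \<and> 0 < C \<and>
           (\<forall>N\<ge>1. \<forall>f\<in>Lp_space N 2.
              X_norm N p q f
                \<le> ennreal C * ennpow (cube_sup N p f) \<mu> * ennpow (Lp_norm N 2 f) (1 - \<mu> * p) \<and>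
              ennreal C * ennpow (cube_sup N p f) \<mu> * ennpow (Lp_norm N 2 f) (1 - \<mu> * p)
                \<le> ennreal C * Lp_norm N 2 f)) \<and>
         (\<forall>N\<ge>1. continuously_embedded (Lp_space N 2) (Lp_norm N 2) (X_space N p q) (X_norm N p q) \<and>
                 Lp_space N 2 \<noteq> X_space N p q)"
proof -
  have p: "0 < p" "p < 2" using assms by auto
  \<comment> \<open>Any exponent strictly between \<open>2\<close> and \<open>q\<close> would do.\<close>
  define r where "r = (2 + q) / 2"
  have r: "2 < r" "r < q" using assms by (auto simp: r_def)
  define \<mu> where "\<mu> = (q - r) / (p * q)"
  define C where "C = embedding_const p r powr (1 / q)"
  have \<mu>: "0 < \<mu>" "\<mu> < 1 / p"
    using p r by (auto simp: \<mu>_def field_simps)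
  have \<mu>p: "1 - \<mu> * p = r / q"
    using p r by (simp add: \<mu>_def field_simps)
  have "0 < C"
    using geo_const_pos[of "2 - p"] geo_const_pos[of "r - 2"] p r
    by (auto simp: C_def embedding_const_def intro!: add_nonneg_pos mult_pos_pos less_imp_neq[symmetric])
  have first: "X_norm N p q f \<le> ennreal C * ennpow (cube_sup N p f) \<mu> * ennpow (Lp_norm N 2 f) (1 - \<mu> * p)"
    if "1 \<le> N" "f \<in> Lp_space N 2" for N f
    using X_norm_le_interpolation[OF that(1) p r that(2)] unfolding C_def \<mu>p unfolding \<mu>_def .
  have second: "ennreal C * ennpow (cube_sup N p f) \<mu> * ennpow (Lp_norm N 2 f) (1 - \<mu> * p) \<le> ennreal C * Lp_norm N 2 f"
    if "f \<in> Lp_space N 2" for N f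
    using interpolation_le_Lp_norm[OF p \<mu>(1), of f N] that
    by (simp add: mult.assoc mult_left_mono Lp_space_def)
  have "continuously_embedded (Lp_space N 2) (Lp_norm N 2) (X_space N p q) (X_norm N p q)" if "1 \<le> N" for N
    using that p \<open>0 < C\<close> by (rule continuously_embedded_Lp_X) (rule order.trans[OF first[OF that] second])
  moreover have "Lp_space N 2 \<noteq> X_space N p q" if "1 \<le> N" for N
    using spikes_in_X_space[OF that p assms(1)] spikes_notin_Lp_space[OF that] by blast
  ultimately show ?thesis
    using \<mu> \<open>0 < C\<close> first second by blast
qed

end
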